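(* Let $(R_0,\mathfrak m_0)$ be a regular local ring containing a field of characteristic zero and let $R=R_0[x_1,\ldots,x_t]$ be the polynomial ring graded in the usual way, i.e. $R_0$ in degree $0$ and $\deg(x_i)=1$ for all $i=1,\ldots,t$; let $R_+=(x_1,\ldots,x_t)$. Then $R_+$ cannot be h-linked (by any ideal $I$, over $R$) with any homogeneous ideal $\mathfrak a\supsetneq R_+$. Moreover, if $\mathfrak a$ is a homogeneous ideal with $\mathfrak a\nsubseteq R_+$ such that $\mathfrak a$ and $R_+$ are h-linked by $I$ over $R$, then $\mathfrak a$ and $R_+$ are geometrically h-linked by $I$ over $R$.
   Context: For a graded ring $R$ and a finitely generated graded $R$-module $M$, homogeneous ideals $\mathfrak a,\mathfrak b$ of $R$ are h-linked by $I$ over $M$ if $\mathfrak aM\neq M\neq\mathfrak bM$, $I\subseteq\mathfrak a\cap\mathfrak b$ is an ideal generated by a homogeneous $M$-regular sequence (possibly empty, i.e. $I=0$), $\mathfrak bM=IM:_M\mathfrak a$ and $\mathfrak aM=IM:_M\mathfrak b$. They are geometrically h-linked by $I$ over $M$ if, in addition, $\mathfrak aM\cap\mathfrak bM=IM$. Here these notions are used with $M=R$. *)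

theory Defs
  imports "HOL-Algebra.Algebra" "HOL-Library.Extended_Nat"
begin

section \<open>Regular local rings\<close>

definition local_ring :: "('a, 'b) ring_scheme \<Rightarrow> 'a set \<Rightarrow> bool" where
  "local_ring R \<mm> \<longleftrightarrow> cring R \<and> maximalideal \<mm> R \<and> (\<forall>J. maximalideal J R \<longrightarrow> J = \<mm>)"

definition krull_dim :: "('a, 'b) ring_scheme \<Rightarrow> enat" where
  "krull_dim R =
     Sup {enat n | n P. (\<forall>i\<le>n. primeideal (P i) R) \<and> (\<forall>i<n. P i \<subset> P (Suc i))}"

text \<open>The minimal number of generators of an ideal; infinite if it is not finitely generated.\<close>

definition min_num_gens :: "('a, 'b) ring_scheme \<Rightarrow> 'a set \<Rightarrow> enat" where
  "min_num_gens R J =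
     Inf {enat (card S) | S. S \<subseteq> carrier R \<and> finite S \<and> J = genideal R S}"

definition regular_local_ring :: "('a, 'b) ring_scheme \<Rightarrow> 'a set \<Rightarrow> bool" where
  "regular_local_ring R \<mm> \<longleftrightarrow>
     noetherian_ring R \<and> local_ring R \<mm> \<and> min_num_gens R \<mm> = krull_dim R"

text \<open>A subfield contains the identity of the ambient ring and inherits its addition, so its
  characteristic is read off from the multiples of that identity.\<close>

definition contains_char_zero_field :: "('a, 'b) ring_scheme \<Rightarrow> bool" where
  "contains_char_zero_field R \<longleftrightarrow>
     (\<exists>k. subfield k R \<and> (\<forall>n::nat. n > 0 \<longrightarrow> add_pow R n \<one>\<^bsub>R\<^esub> \<noteq> \<zero>\<^bsub>R\<^esub>))"


section \<open>Polynomial rings in finitely many variables\<close>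

text \<open>\<^theory>\<open>HOL-Algebra.Indexed_Polynomials\<close> represents a monomial by the multiset of
  its variables and a polynomial by its coefficient function, but it only provides
  multiplication by a variable. The product below is the convolution, summing over the finitely
  many factorisations of a monomial. The variables are indexed by \<open>1, \<dots>, t\<close>.\<close>

definition mpoly_ring :: "('a, 'b) ring_scheme \<Rightarrow> nat \<Rightarrow> (nat multiset \<Rightarrow> 'a) ring" where
  "mpoly_ring R\<^sub>0 t =
     \<lparr>carrier = ring.indexed_pset R\<^sub>0 {1..t} (carrier R\<^sub>0),
      monoid.mult = (\<lambda>P Q m. finsum R\<^sub>0 (\<lambda>k. P k \<otimes>\<^bsub>R\<^sub>0\<^esub> Q (m - k)) {k. k \<subseteq># m}),
      monoid.one = ring.indexed_const R\<^sub>0 \<one>\<^bsub>R\<^sub>0\<^esub>,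
      ring.zero = ring.indexed_const R\<^sub>0 \<zero>\<^bsub>R\<^sub>0\<^esub>,
      ring.add = ring.indexed_padd R\<^sub>0\<rparr>"

text \<open>The standard grading: the size of a multiset is the total degree of the monomial.\<close>

definition mpoly_grading ::
    "('a, 'b) ring_scheme \<Rightarrow> nat \<Rightarrow> nat \<Rightarrow> (nat multiset \<Rightarrow> 'a) set" where
  "mpoly_grading R\<^sub>0 t n =
     {P \<in> carrier (mpoly_ring R\<^sub>0 t). \<forall>m. P m \<noteq> \<zero>\<^bsub>R\<^sub>0\<^esub> \<longrightarrow> size m = n}"

definition irrelevant_ideal ::
    "('a, 'b) ring_scheme \<Rightarrow> nat \<Rightarrow> (nat multiset \<Rightarrow> 'a) set" where
  "irrelevant_ideal R\<^sub>0 t = genideal (mpoly_ring R\<^sub>0 t) (ring.indexed_var R\<^sub>0 ` {1..t})"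


section \<open>Linkage of homogeneous ideals\<close>

text \<open>In this section \<open>G n\<close> is the set of homogeneous elements of degree \<open>n\<close> of a graded
  ring \<open>R\<close> (including zero).\<close>

definition homogeneous_ideal ::
    "('a, 'b) ring_scheme \<Rightarrow> (nat \<Rightarrow> 'a set) \<Rightarrow> 'a set \<Rightarrow> bool" where
  "homogeneous_ideal R G J \<longleftrightarrow> ideal J R \<and> (\<exists>S \<subseteq> (\<Union>n. G n). J = genideal R S)"

definition ideal_colon :: "('a, 'b) ring_scheme \<Rightarrow> 'a set \<Rightarrow> 'a set \<Rightarrow> 'a set" where
  "ideal_colon R I J = {r \<in> carrier R. \<forall>s\<in>J. s \<otimes>\<^bsub>R\<^esub> r \<in> I}"

text \<open>Each \<open>fs ! i\<close> is a non-zerodivisor modulo the ideal generated by its predecessors, and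
  the whole sequence generates a proper ideal. The empty sequence generates the zero ideal.\<close>

definition regular_sequence :: "('a, 'b) ring_scheme \<Rightarrow> 'a list \<Rightarrow> bool" where
  "regular_sequence R fs \<longleftrightarrow>
     set fs \<subseteq> carrier R \<and>
     (\<forall>i<length fs. \<forall>r\<in>carrier R.
        fs ! i \<otimes>\<^bsub>R\<^esub> r \<in> genideal R (set (take i fs)) \<longrightarrow> r \<in> genideal R (set (take i fs))) \<and>
     genideal R (set fs) \<noteq> carrier R"

text \<open>Linkage over a graded module \<open>M\<close> in the case \<open>M = R\<close>, where \<open>\<aa>M\<close> is \<open>\<aa>\<close> itself.\<close>

definition h_linked ::
    "('a, 'b) ring_scheme \<Rightarrow> (nat \<Rightarrow> 'a set) \<Rightarrow> 'a set \<Rightarrow> 'a set \<Rightarrow> 'a set \<Rightarrow> bool" where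
  "h_linked R G I \<aa> \<bb> \<longleftrightarrow>
     homogeneous_ideal R G \<aa> \<and> homogeneous_ideal R G \<bb> \<and>
     \<aa> \<noteq> carrier R \<and> \<bb> \<noteq> carrier R \<and>
     I \<subseteq> \<aa> \<inter> \<bb> \<and>
     (\<exists>fs. set fs \<subseteq> (\<Union>n. G n) \<and> regular_sequence R fs \<and> I = genideal R (set fs)) \<and>
     \<bb> = ideal_colon R I \<aa> \<and> \<aa> = ideal_colon R I \<bb>"

definition geometrically_h_linked ::
    "('a, 'b) ring_scheme \<Rightarrow> (nat \<Rightarrow> 'a set) \<Rightarrow> 'a set \<Rightarrow> 'a set \<Rightarrow> 'a set \<Rightarrow> bool" where
  "geometrically_h_linked R G I \<aa> \<bb> \<longleftrightarrow> h_linked R G I \<aa> \<bb> \<and> \<aa> \<inter> \<bb> = I"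

end

theory Submission
  imports Defs
begin

text \<open>
  Let \<open>f\<^sub>1, \<dots>, f\<^sub>n\<close> be a regular sequence of homogeneous polynomials of degrees \<open>d\<^sub>1, \<dots>, d\<^sub>n\<close>
  generating \<open>I\<close>, let \<open>E = \<Sum>\<^sub>i x\<^sub>i \<partial>\<^sub>i\<close> be the Euler operator, and let \<open>y R\<^sub>+ \<subseteq> I\<close>. Write
  \<open>y x\<^sub>i = \<Sum>\<^sub>j h\<^sub>i\<^sub>j f\<^sub>j\<close>. Applying \<open>\<partial>\<^sub>i\<close> and summing over \<open>i\<close> gives
  \<open>E y + t y \<equiv> \<Sum>\<^sub>i\<^sub>j h\<^sub>i\<^sub>j \<partial>\<^sub>i f\<^sub>j\<close> modulo \<open>I\<close>. On the other hand
  \<open>d\<^sub>l y f\<^sub>l = \<Sum>\<^sub>i (\<partial>\<^sub>i f\<^sub>l) y x\<^sub>i = \<Sum>\<^sub>j (\<Sum>\<^sub>i h\<^sub>i\<^sub>j \<partial>\<^sub>i f\<^sub>l) f\<^sub>j\<close>, and since the coefficients of every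
  relation between members of a regular sequence lie in the ideal that it generates,
  \<open>\<Sum>\<^sub>i h\<^sub>i\<^sub>l \<partial>\<^sub>i f\<^sub>l \<equiv> d\<^sub>l y\<close>. Summing over \<open>l\<close>,
  \<open>E y + (t - \<Sum>\<^sub>l d\<^sub>l) y \<in> I\<close>.

  If \<open>\<aa> = I : R\<^sub>+\<close> is not contained in \<open>R\<^sub>+\<close>, it contains a nonzero constant \<open>c\<close>, and \<open>y = c\<close> forces
  \<open>t = \<Sum>\<^sub>l d\<^sub>l\<close>, because \<open>I \<subseteq> R\<^sub>+\<close> and the characteristic is zero. Hence \<open>E y \<in> I\<close> for all
  \<open>y \<in> \<aa> \<inter> R\<^sub>+\<close>, so that \<open>y \<in> I\<close>, since \<open>E\<close> multiplies the component of degree \<open>e\<close> by the unit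
  \<open>e > 0\<close>. This proves \<open>\<aa> \<inter> R\<^sub>+ = I\<close>. If moreover \<open>R\<^sub>+ \<subseteq> \<aa>\<close>, then \<open>R\<^sub>+ = I\<close> and \<open>\<aa> = I : I = R\<close>.
\<close>

section \<open>Relations between members of a regular sequence\<close>

text \<open>The sum of \<open>Idl (set fs)\<close> and \<open>PIdl f\<close> is an ideal containing
  all the generators, so minimality of the generated ideal places \<open>z\<close> in it. Splitting
  off the last member drives the inductions along a sequence.\<close>

lemma (in cring) genideal_snocE:
  assumes "set fs \<subseteq> carrier R" "f \<in> carrier R" "z \<in> Idl (set (fs @ [f]))"
  obtains u r where "u \<in> Idl (set fs)" "r \<in> carrier R" "z = u \<oplus> r \<otimes> f"
proof -
  have ids: "ideal (Idl (set fs)) R" "ideal (PIdl f) R"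
    using assms genideal_ideal cgenideal_ideal by auto
  interpret a: ideal "Idl (set fs)" R by (rule ids)
  interpret b: ideal "PIdl f" R by (rule ids)
  have add_mem: "a \<oplus> b \<in> A <+> B" if "a \<in> A" "b \<in> B" for a b A B
    using that unfolding set_add_def' by blast
  have "set (fs @ [f]) \<subseteq> Idl (set fs) <+> PIdl f"
  proof
    fix g assume "g \<in> set (fs @ [f])"
    then consider "g \<in> set fs" | "g = f" by auto
    then show "g \<in> Idl (set fs) <+> PIdl f"
    proof cases
      case 1
      then have "g \<in> Idl (set fs)" "g \<in> carrier R"
        using assms(1) genideal_self by auto
      then show ?thesis using add_mem[of g "Idl (set fs)" \<zero> "PIdl f"] b.zero_closed by simp
    next
      case 2
      then show ?thesis
        using add_mem[of \<zero> "Idl (set fs)" g "PIdl f"] assms(2) cgenideal_self a.zero_closed by simp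
    qed
  qed
  then have "z \<in> Idl (set fs) <+> PIdl f"
    using genideal_minimal[OF add_ideals[OF ids]] assms(3) by blast
  then obtain u v where uv: "u \<in> Idl (set fs)" "v \<in> PIdl f" "z = u \<oplus> v"
    unfolding set_add_def' by blast
  then obtain r where "r \<in> carrier R" "v = r \<otimes> f"
    unfolding cgenideal_def by blast
  then show thesis using uv by (intro that[of u r]) simp_all
qed

lemma (in cring) genideal_listE:
  assumes "set fs \<subseteq> carrier R" "z \<in> Idl (set fs)"
  obtains h where "\<And>j. h j \<in> carrier R" "z = (\<Oplus>j\<in>{..<length fs}. h j \<otimes> fs ! j)"
  using assms
proof (induction fs arbitrary: z thesis rule: rev_induct)
  case Nil
  have "Idl {} \<subseteq> {\<zero>}"
    by (rule genideal_minimal[OF zeroideal]) simp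
  then show ?case using Nil by fastforce
next
  case (snoc f fs)
  have c: "set fs \<subseteq> carrier R" "f \<in> carrier R" using snoc.prems by auto
  obtain u r where ur: "u \<in> Idl (set fs)" "r \<in> carrier R" "z = u \<oplus> r \<otimes> f"
    by (rule genideal_snocE[OF c snoc.prems(3)])
  obtain h where h: "\<And>j. h j \<in> carrier R" "u = (\<Oplus>j\<in>{..<length fs}. h j \<otimes> fs ! j)"
    using snoc.IH[OF _ c(1) ur(1)] by metis
  have cf: "fs ! j \<in> carrier R" if "j < length fs" for j using c that nth_mem by blast
  \<comment> \<open>The new coefficient sits at the index of \<open>f\<close>; all earlier
    coefficients stay unchanged.\<close>
  let ?h = "h(length fs := r)"
  have "(\<Oplus>j\<in>{..<length (fs @ [f])}. ?h j \<otimes> (fs @ [f]) ! j)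
      = r \<otimes> f \<oplus> (\<Oplus>j\<in>{..<length fs}. ?h j \<otimes> (fs @ [f]) ! j)"
    using h c cf ur by (simp add: lessThan_Suc) (subst finsum_insert, auto simp: nth_append)
  also have "(\<Oplus>j\<in>{..<length fs}. ?h j \<otimes> (fs @ [f]) ! j) = u"
    unfolding h(2) using h(1) cf by (intro finsum_cong') (auto simp: nth_append)
  finally have "z = (\<Oplus>j\<in>{..<length (fs @ [f])}. ?h j \<otimes> (fs @ [f]) ! j)"
    using ur c h cf by (simp add: a_comm)
  then show ?case using snoc.prems(1)[of ?h] h(1) ur(2) by simp
qed

lemma (in ideal) finsum_mem:
  assumes "\<And>i. i \<in> A \<Longrightarrow> f i \<in> I"
  shows "(\<Oplus>i\<in>A. f i) \<in> I"
  using assms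
proof (induction A rule: infinite_finite_induct)
  case (insert a A)
  then have "f a \<in> carrier R" "f \<in> A \<rightarrow> carrier R" using Icarr by auto
  then show ?case using insert by simp
qed auto

lemma (in ideal) add_pow_mem: "a \<in> I \<Longrightarrow> add_pow R (k :: nat) a \<in> I"
  by (induction k) auto

lemma (in ideal) minus_mem_cancel:
  assumes "a \<in> I" "a \<ominus> b \<in> I" "b \<in> carrier R"
  shows "b \<in> I"
proof -
  have "a \<in> carrier R" using assms(1) by (rule Icarr)
  then have "a \<oplus> \<ominus> (a \<ominus> b) = b" using assms(3) by algebra
  moreover have "a \<oplus> \<ominus> (a \<ominus> b) \<in> I" using assms(1,2) by blast
  ultimately show ?thesis by simp
qed

text \<open>Induction from the end of the sequence. Regularity puts the last coefficient into the
  ideal of the preceding members. Expanding it in those members and substituting yields a shorter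
  relation, whose coefficients differ from the old ones by multiples of \<open>f\<close>.\<close>

lemma (in cring) regular_sequence_relation:
  assumes "set fs \<subseteq> carrier R"
    and "\<And>i r. i < length fs \<Longrightarrow> r \<in> carrier R \<Longrightarrow> fs ! i \<otimes> r \<in> Idl (set (take i fs)) \<Longrightarrow>
           r \<in> Idl (set (take i fs))"
    and "\<And>j. j < length fs \<Longrightarrow> g j \<in> carrier R"
    and "(\<Oplus>j\<in>{..<length fs}. g j \<otimes> fs ! j) = \<zero>"
    and "j < length fs"
  shows "g j \<in> Idl (set fs)"
  using assms
proof (induction fs arbitrary: g j rule: rev_induct)
  case Nil
  then show ?case by simp
next
  case (snoc f fs)
  let ?n = "length fs"
  have c: "set fs \<subseteq> carrier R" "f \<in> carrier R" using snoc.prems by auto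
  have cf: "fs ! j \<in> carrier R" if "j < ?n" for j using c that nth_mem by blast
  have cg: "g j \<in> carrier R" if "j \<le> ?n" for j using snoc.prems(3) that by simp
  interpret J: ideal "Idl (set fs)" R using genideal_ideal[OF c(1)] .
  interpret J': ideal "Idl (set (fs @ [f]))" R
    using genideal_ideal snoc.prems(1) by blast
  have sub: "Idl (set fs) \<subseteq> Idl (set (fs @ [f]))"
    using subset_Idl_subset[OF snoc.prems(1)] by auto
  have f: "f \<in> Idl (set (fs @ [f]))"
    using genideal_self[OF snoc.prems(1)] by auto
  let ?s = "\<Oplus>j\<in>{..<?n}. g j \<otimes> fs ! j"
  have s: "?s \<in> Idl (set fs)"
    using genideal_self[OF c(1)] cg by (intro J.finsum_mem J.I_l_closed) auto
  have "(\<Oplus>j\<in>{..<length (fs @ [f])}. g j \<otimes> (fs @ [f]) ! j)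
      = g ?n \<otimes> f \<oplus> (\<Oplus>j\<in>{..<?n}. g j \<otimes> (fs @ [f]) ! j)"
    using c cf cg by (simp add: lessThan_Suc) (subst finsum_insert, auto simp: nth_append)
  also have "(\<Oplus>j\<in>{..<?n}. g j \<otimes> (fs @ [f]) ! j) = ?s"
    using cg cf by (intro finsum_cong') (auto simp: nth_append)
  finally have sum: "g ?n \<otimes> f \<oplus> ?s = \<zero>" using snoc.prems(4) by simp
  then have "f \<otimes> g ?n = \<ominus> ?s"
    using c cg cf s J.Icarr by (simp add: m_comm minus_equality)
  then have "f \<otimes> g ?n \<in> Idl (set fs)" using s by simp
  then have gn: "g ?n \<in> Idl (set fs)"
    using snoc.prems(2)[of ?n "g ?n"] cg by simp
  obtain h where h: "\<And>j. h j \<in> carrier R" "g ?n = (\<Oplus>j\<in>{..<?n}. h j \<otimes> fs ! j)"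
    by (rule genideal_listE[OF c(1) gn]) blast
  \<comment> \<open>The last term \<open>g ?n \<otimes> f\<close> is distributed over the earlier
    members through the expansion of \<open>g ?n\<close>; this gives a relation among
    \<open>fs\<close> alone.\<close>
  have "(\<Oplus>j\<in>{..<?n}. (g j \<oplus> h j \<otimes> f) \<otimes> fs ! j) =
      (\<Oplus>j\<in>{..<?n}. g j \<otimes> fs ! j \<oplus> (h j \<otimes> fs ! j) \<otimes> f)"
  proof (intro finsum_cong' funcsetI)
    fix j assume "j \<in> {..<?n}"
    then have "g j \<in> carrier R" "h j \<in> carrier R" "fs ! j \<in> carrier R" "f \<in> carrier R"
      using cg h cf c by auto
    then show "(g j \<oplus> h j \<otimes> f) \<otimes> fs ! j = g j \<otimes> fs ! j \<oplus> (h j \<otimes> fs ! j) \<otimes> f"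
      "g j \<otimes> fs ! j \<oplus> (h j \<otimes> fs ! j) \<otimes> f \<in> carrier R"
      by algebra+
  qed simp
  also have "\<dots> = ?s \<oplus> (\<Oplus>j\<in>{..<?n}. (h j \<otimes> fs ! j) \<otimes> f)"
    using cg h cf c by (intro finsum_addf) auto
  also have "(\<Oplus>j\<in>{..<?n}. (h j \<otimes> fs ! j) \<otimes> f) = g ?n \<otimes> f"
    unfolding h(2) using h(1) cf c by (subst finsum_ldistr) auto
  finally have rel: "(\<Oplus>j\<in>{..<?n}. (g j \<oplus> h j \<otimes> f) \<otimes> fs ! j) = \<zero>"
    using sum s J.Icarr cg c by (simp add: a_comm)
  have nzd: "r \<in> Idl (set (take i fs))"
    if "i < ?n" "r \<in> carrier R" "fs ! i \<otimes> r \<in> Idl (set (take i fs))" for i r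
    using snoc.prems(2)[of i r] that by (simp add: nth_append)
  show ?case
  proof (cases "j = ?n")
    case True
    then show ?thesis using gn sub by blast
  next
    case False
    then have j: "j < ?n" using snoc.prems(5) by simp
    have "g j \<oplus> h j \<otimes> f \<in> Idl (set fs)"
      using snoc.IH[OF c(1) nzd _ rel j] cg h c by auto
    then have "g j \<oplus> h j \<otimes> f \<in> Idl (set (fs @ [f]))" using sub by blast
    moreover have "h j \<otimes> f \<in> Idl (set (fs @ [f]))" using J'.I_l_closed[OF f] h by blast
    ultimately have "(g j \<oplus> h j \<otimes> f) \<ominus> h j \<otimes> f \<in> Idl (set (fs @ [f]))"
      unfolding a_minus_def by (rule J'.a_closed[OF _ J'.a_inv_closed])
    moreover have "(g j \<oplus> h j \<otimes> f) \<ominus> h j \<otimes> f = g j"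
    proof -
      have "g j \<in> carrier R" "h j \<otimes> f \<in> carrier R" using cg h c j by auto
      then show ?thesis by algebra
    qed
    ultimately show ?thesis by simp
  qed
qed


section \<open>The Euler operator\<close>

lemma (in abelian_monoid) finsum_swap:
  assumes "finite A" "finite B" "\<And>i j. i \<in> A \<Longrightarrow> j \<in> B \<Longrightarrow> f i j \<in> carrier G"
  shows "(\<Oplus>i\<in>A. \<Oplus>j\<in>B. f i j) = (\<Oplus>j\<in>B. \<Oplus>i\<in>A. f i j)"
  using assms(1,3)
proof (induction A rule: finite_induct)
  case empty
  then show ?case by simp
next
  case (insert a A)
  have "(\<Oplus>i\<in>insert a A. \<Oplus>j\<in>B. f i j) = (\<Oplus>j\<in>B. f a j) \<oplus> (\<Oplus>j\<in>B. \<Oplus>i\<in>A. f i j)"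
    using insert by (subst finsum_insert) (auto intro!: finsum_closed)
  also have "\<dots> = (\<Oplus>j\<in>B. f a j \<oplus> (\<Oplus>i\<in>A. f i j))"
    using insert.prems by (subst finsum_addf) (auto intro!: finsum_closed)
  also have "\<dots> = (\<Oplus>j\<in>B. \<Oplus>i\<in>insert a A. f i j)"
    using insert.hyps insert.prems by (intro finsum_cong') (auto intro!: finsum_closed)
  finally show ?case .
qed

lemma (in abelian_monoid) finsum_add_pow:
  fixes d :: "'c \<Rightarrow> nat"
  assumes "y \<in> carrier G" "finite A"
  shows "(\<Oplus>j\<in>A. add_pow G (d j) y) = add_pow G (\<Sum>j\<in>A. d j) y"
  using assms(2)
proof (induction A rule: finite_induct)
  case (insert a A)
  then show ?case using assms(1) by (simp add: add.nat_pow_mult)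
qed simp

text \<open>This isolates what the derivation argument uses of a polynomial ring, so that it runs
  without coefficient functions. Only the diagonal values \<delta> i (x i) are prescribed, because a
  product with \<open>x i\<close> is only ever differentiated in the direction
  \<open>i\<close>.\<close>

locale coordinate_derivations = cring R for R (structure) +
  fixes T :: "'i set" and x :: "'i \<Rightarrow> 'a" and \<delta> :: "'i \<Rightarrow> 'a \<Rightarrow> 'a"
  assumes finite_T: "finite T"
    and x_closed: "i \<in> T \<Longrightarrow> x i \<in> carrier R"
    and der_closed: "i \<in> T \<Longrightarrow> a \<in> carrier R \<Longrightarrow> \<delta> i a \<in> carrier R"
    and der_add: "i \<in> T \<Longrightarrow> a \<in> carrier R \<Longrightarrow> b \<in> carrier R \<Longrightarrow> \<delta> i (a \<oplus> b) = \<delta> i a \<oplus> \<delta> i b"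
    and der_mult: "i \<in> T \<Longrightarrow> a \<in> carrier R \<Longrightarrow> b \<in> carrier R \<Longrightarrow>
           \<delta> i (a \<otimes> b) = \<delta> i a \<otimes> b \<oplus> a \<otimes> \<delta> i b"
    and der_x: "i \<in> T \<Longrightarrow> \<delta> i (x i) = \<one>"
begin

definition euler :: "'a \<Rightarrow> 'a" where
  "euler a = (\<Oplus>i\<in>T. x i \<otimes> \<delta> i a)"

lemma euler_closed [simp]: "a \<in> carrier R \<Longrightarrow> euler a \<in> carrier R"
  unfolding euler_def using x_closed der_closed by (intro finsum_closed) auto

lemma der_zero: "i \<in> T \<Longrightarrow> \<delta> i \<zero> = \<zero>"
  using der_add[of i \<zero> \<zero>] der_closed[of i \<zero>] by simp

lemma der_finsum:
  assumes "i \<in> T" "finite A" "\<And>j. j \<in> A \<Longrightarrow> f j \<in> carrier R"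
  shows "\<delta> i (\<Oplus>j\<in>A. f j) = (\<Oplus>j\<in>A. \<delta> i (f j))"
  using assms(2,3)
proof (induction A rule: finite_induct)
  case empty
  then show ?case using assms(1) by (simp add: der_zero)
next
  case (insert a A)
  then have "(\<Oplus>j\<in>A. f j) \<in> carrier R" by (intro finsum_closed) auto
  with insert show ?case
    using assms(1) der_closed by (subst finsum_insert) (auto simp: der_add Pi_def)
qed

lemma euler_zero: "euler \<zero> = \<zero>"
proof -
  have "euler \<zero> = (\<Oplus>i\<in>T. \<zero>)"
    unfolding euler_def using der_zero x_closed by (intro finsum_cong') auto
  then show ?thesis by simp
qed

lemma euler_add:
  assumes "a \<in> carrier R" "b \<in> carrier R"
  shows "euler (a \<oplus> b) = euler a \<oplus> euler b"
proof -
  have "euler (a \<oplus> b) = (\<Oplus>i\<in>T. x i \<otimes> \<delta> i a \<oplus> x i \<otimes> \<delta> i b)"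
    unfolding euler_def using assms x_closed der_closed
    by (intro finsum_cong') (auto simp: der_add r_distr)
  then show ?thesis
    unfolding euler_def using assms x_closed der_closed
    by (simp add: finsum_addf Pi_def)
qed

lemma euler_mult:
  assumes "a \<in> carrier R" "b \<in> carrier R"
  shows "euler (a \<otimes> b) = euler a \<otimes> b \<oplus> a \<otimes> euler b"
proof -
  have "euler (a \<otimes> b) = (\<Oplus>i\<in>T. (x i \<otimes> \<delta> i a) \<otimes> b \<oplus> a \<otimes> (x i \<otimes> \<delta> i b))"
    unfolding euler_def
  proof (intro finsum_cong' funcsetI)
    fix i assume "i \<in> T"
    then have "x i \<in> carrier R" "\<delta> i a \<in> carrier R" "\<delta> i b \<in> carrier R"
      using assms x_closed der_closed by auto
    then show "x i \<otimes> \<delta> i (a \<otimes> b) = (x i \<otimes> \<delta> i a) \<otimes> b \<oplus> a \<otimes> (x i \<otimes> \<delta> i b)"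
      "(x i \<otimes> \<delta> i a) \<otimes> b \<oplus> a \<otimes> (x i \<otimes> \<delta> i b) \<in> carrier R"
      using assms unfolding der_mult[OF \<open>i \<in> T\<close> assms] by algebra+
  qed simp
  also have "\<dots> = (\<Oplus>i\<in>T. (x i \<otimes> \<delta> i a) \<otimes> b) \<oplus> (\<Oplus>i\<in>T. a \<otimes> (x i \<otimes> \<delta> i b))"
    using assms x_closed der_closed by (intro finsum_addf) auto
  also have "\<dots> = euler a \<otimes> b \<oplus> a \<otimes> euler b"
    unfolding euler_def using assms x_closed der_closed finite_T
    by (simp add: finsum_ldistr finsum_rdistr Pi_def)
  finally show ?thesis .
qed

lemma euler_a_inv:
  assumes "a \<in> carrier R"
  shows "euler (\<ominus> a) = \<ominus> euler a"
proof -
  have "euler a \<oplus> euler (\<ominus> a) = \<zero>"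
    using assms by (simp add: euler_add[symmetric] r_neg euler_zero)
  then show ?thesis
    using assms by (metis a_inv_closed euler_closed minus_equality a_comm)
qed

text \<open>By the Leibniz rule, the members of \<open>Idl F\<close> that \<open>euler\<close> keeps
  inside \<open>Idl F\<close> form an ideal, so it is enough to check generators.\<close>

lemma euler_genideal:
  assumes F: "F \<subseteq> carrier R" and eF: "\<And>f. f \<in> F \<Longrightarrow> euler f \<in> Idl F" and z: "z \<in> Idl F"
  shows "euler z \<in> Idl F"
proof -
  interpret I: ideal "Idl F" R using genideal_ideal[OF F] .
  let ?J = "{a \<in> Idl F. euler a \<in> Idl F}"
  have "ideal ?J R"
  proof (intro idealI[OF ring_axioms] subgroup.intro)
    fix a assume "a \<in> ?J"
    then have a: "a \<in> carrier R" "a \<in> Idl F" "euler a \<in> Idl F" using I.Icarr by auto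
    then show "inv\<^bsub>add_monoid R\<^esub> a \<in> ?J"
      using a by (simp add: euler_a_inv flip: a_inv_def)
  qed (use I.Icarr in \<open>auto simp: euler_zero euler_add euler_mult I.I_l_closed I.I_r_closed\<close>)
  moreover have "F \<subseteq> ?J" using genideal_self[OF F] eF by auto
  ultimately have "Idl F \<subseteq> ?J" by (rule genideal_minimal)
  then show ?thesis using z by blast
qed

text \<open>The congruence for E y is derived as an equation in the quotient \<open>S\<close>, where
  all terms carrying a factor \<open>fs ! j\<close> vanish. \<open>A\<close> differentiates the
  expansions of \<open>y \<otimes> x i\<close>; \<open>B\<close> evaluates the resulting sums, one
  for each member of the sequence.\<close>

lemma euler_colon:
  fixes d :: "nat \<Rightarrow> nat"
  assumes fs: "set fs \<subseteq> carrier R"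
    and reg: "\<And>i r. i < length fs \<Longrightarrow> r \<in> carrier R \<Longrightarrow> fs ! i \<otimes> r \<in> Idl (set (take i fs)) \<Longrightarrow>
           r \<in> Idl (set (take i fs))"
    and hom: "\<And>j. j < length fs \<Longrightarrow> euler (fs ! j) = add_pow R (d j) (fs ! j)"
    and y: "y \<in> carrier R" "\<And>i. i \<in> T \<Longrightarrow> y \<otimes> x i \<in> Idl (set fs)"
  shows "(euler y \<oplus> add_pow R (card T) y) \<ominus> add_pow R (\<Sum>j<length fs. d j) y \<in> Idl (set fs)"
proof -
  define n where "n = length fs"
  define I where "I = Idl (set fs)"
  define S where "S = R Quot I"
  define \<pi> where "\<pi> = (+>) I"
  interpret I: ideal I R unfolding I_def using genideal_ideal[OF fs] .
  interpret q: ring_hom_cring R S \<pi>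
    unfolding S_def \<pi>_def by (rule I.rcos_ring_hom_cring[OF is_cring])
  have \<pi>_eq: "\<pi> a = \<pi> b \<longleftrightarrow> a \<ominus> b \<in> I" if "a \<in> carrier R" "b \<in> carrier R" for a b
    unfolding \<pi>_def using quotient_eq_iff_same_a_r_cos[OF I.is_ideal that] by auto
  have \<pi>_0: "\<pi> a = \<zero>\<^bsub>S\<^esub>" if "a \<in> I" for a
    using \<pi>_eq[of a \<zero>] that I.Icarr by (auto simp: a_minus_def)
  have \<pi>_pow: "\<pi> (add_pow R k a) = add_pow S k (\<pi> a)" if "a \<in> carrier R" for a and k :: nat
    using that by (induction k) auto
  have f: "fs ! j \<in> carrier R" "fs ! j \<in> I" if "j < n" for j
    using that fs genideal_self[OF fs] unfolding n_def I_def by (auto dest: nth_mem)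
  have "\<forall>i\<in>T. \<exists>h. (\<forall>j. h j \<in> carrier R) \<and> y \<otimes> x i = (\<Oplus>j\<in>{..<n}. h j \<otimes> fs ! j)"
    using genideal_listE[OF fs y(2)] unfolding n_def by metis
  then obtain h where h: "\<And>i j. i \<in> T \<Longrightarrow> h i j \<in> carrier R"
    "\<And>i. i \<in> T \<Longrightarrow> y \<otimes> x i = (\<Oplus>j\<in>{..<n}. h i j \<otimes> fs ! j)"
    by metis
  note [simp] = f(1) h(1) x_closed der_closed y(1) finite_T
  have A: "\<pi> (x i \<otimes> \<delta> i y) \<oplus>\<^bsub>S\<^esub> \<pi> y = (\<Oplus>\<^bsub>S\<^esub>j\<in>{..<n}. \<pi> (h i j \<otimes> \<delta> i (fs ! j)))"
    if i: "i \<in> T" for i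
  proof -
    have "\<pi> (x i \<otimes> \<delta> i y) \<oplus>\<^bsub>S\<^esub> \<pi> y = \<pi> (\<delta> i (y \<otimes> x i))"
      using i by (simp add: der_mult der_x q.S.m_comm)
    also have "\<delta> i (y \<otimes> x i) = (\<Oplus>j\<in>{..<n}. \<delta> i (h i j \<otimes> fs ! j))"
      unfolding h(2)[OF i] using i by (intro der_finsum) auto
    also have "\<pi> \<dots> = (\<Oplus>\<^bsub>S\<^esub>j\<in>{..<n}. \<pi> (\<delta> i (h i j \<otimes> fs ! j)))"
      using i by (subst q.hom_finsum) (auto simp: comp_def)
    \<comment> \<open>The other half of the product rule, the derivative of \<open>h i j\<close>
      times \<open>fs ! j\<close>, lies in \<open>I\<close>.\<close>
    also have "\<dots> = (\<Oplus>\<^bsub>S\<^esub>j\<in>{..<n}. \<pi> (h i j \<otimes> \<delta> i (fs ! j)))"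
      using i by (intro q.S.finsum_cong') (auto simp: der_mult \<pi>_0 f(2))
    finally show ?thesis .
  qed
  have B: "(\<Oplus>\<^bsub>S\<^esub>i\<in>T. \<pi> (h i l \<otimes> \<delta> i (fs ! l))) = add_pow S (d l) (\<pi> y)" if l: "l < n" for l
  proof -
    \<comment> \<open>Pairing the expansions of \<open>y \<otimes> x i\<close> with the derivatives
      of the fixed member \<open>fs ! l\<close> gives the sum of the
      \<open>s j \<otimes> fs ! j\<close>, which equals y E(f) for f = \<open>fs ! l\<close>, hence
      \<open>d l\<close> times y f.\<close>
    define s where "s j = (\<Oplus>i\<in>T. h i j \<otimes> \<delta> i (fs ! l))" for j
    \<comment> \<open>Correcting the coefficient at \<open>l\<close> turns this identity into a
      relation with sum zero, to which \<open>regular_sequence_relation\<close> applies.\<close>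
    define g where "g j = s j \<oplus> (if j = l then \<ominus> (add_pow R (d l) y) else \<zero>)" for j
    have s: "s j \<in> carrier R" for j
      unfolding s_def using l by (intro finsum_closed) auto
    have g: "g j \<in> carrier R" for j unfolding g_def using s by auto
    have "(\<Oplus>j\<in>{..<n}. s j \<otimes> fs ! j) = (\<Oplus>j\<in>{..<n}. \<Oplus>i\<in>T. h i j \<otimes> \<delta> i (fs ! l) \<otimes> fs ! j)"
      unfolding s_def using l by (intro finsum_cong') (auto simp: finsum_ldistr Pi_def intro!: finsum_closed)
    also have "\<dots> = (\<Oplus>i\<in>T. \<Oplus>j\<in>{..<n}. h i j \<otimes> \<delta> i (fs ! l) \<otimes> fs ! j)"
      using l by (intro finsum_swap) auto
    also have "\<dots> = (\<Oplus>i\<in>T. y \<otimes> (x i \<otimes> \<delta> i (fs ! l)))"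
    proof (intro finsum_cong' funcsetI)
      fix i assume i: "i \<in> T"
      have "y \<otimes> (x i \<otimes> \<delta> i (fs ! l)) = (\<Oplus>j\<in>{..<n}. h i j \<otimes> fs ! j) \<otimes> \<delta> i (fs ! l)"
        using i l by (simp add: h(2)[symmetric] m_assoc)
      also have "\<dots> = (\<Oplus>j\<in>{..<n}. h i j \<otimes> fs ! j \<otimes> \<delta> i (fs ! l))"
        using i l by (intro finsum_ldistr) auto
      also have "\<dots> = (\<Oplus>j\<in>{..<n}. h i j \<otimes> \<delta> i (fs ! l) \<otimes> fs ! j)"
        using i l by (intro finsum_cong') (auto simp: m_ac)
      finally show "(\<Oplus>j\<in>{..<n}. h i j \<otimes> \<delta> i (fs ! l) \<otimes> fs ! j) = y \<otimes> (x i \<otimes> \<delta> i (fs ! l))"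
        by simp
      show "y \<otimes> (x i \<otimes> \<delta> i (fs ! l)) \<in> carrier R" using i l by simp
    qed simp
    also have "\<dots> = y \<otimes> euler (fs ! l)"
      unfolding euler_def using l by (intro finsum_rdistr[symmetric]) auto
    also have "\<dots> = add_pow R (d l) y \<otimes> fs ! l"
      using l hom[of l] by (simp add: n_def add_pow_rdistr add_pow_ldistr)
    finally have sf: "(\<Oplus>j\<in>{..<n}. s j \<otimes> fs ! j) = add_pow R (d l) y \<otimes> fs ! l" .
    have "(\<Oplus>j\<in>{..<n}. g j \<otimes> fs ! j) =
        (\<Oplus>j\<in>{..<n}. s j \<otimes> fs ! j \<oplus> (if l = j then \<ominus> (add_pow R (d l) y) \<otimes> fs ! j else \<zero>))"
      unfolding g_def using s by (intro finsum_cong') (auto simp: l_distr)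
    also have "\<dots> = (\<Oplus>j\<in>{..<n}. s j \<otimes> fs ! j) \<oplus>
        (\<Oplus>j\<in>{..<n}. if l = j then \<ominus> (add_pow R (d l) y) \<otimes> fs ! j else \<zero>)"
      using s by (intro finsum_addf) auto
    also have "(\<Oplus>j\<in>{..<n}. if l = j then \<ominus> (add_pow R (d l) y) \<otimes> fs ! j else \<zero>) = \<ominus> (add_pow R (d l) y) \<otimes> fs ! l"
      using l by (intro finsum_singleton) auto
    finally have "(\<Oplus>j\<in>{..<n}. g j \<otimes> fs ! j) = \<zero>"
      using l by (simp add: sf l_minus r_neg)
    then have "g l \<in> I"
      using regular_sequence_relation[OF fs reg, of g l] g l unfolding n_def I_def by blast
    then have "\<pi> (s l) = \<pi> (add_pow R (d l) y)"
      unfolding g_def using s by (simp add: \<pi>_eq a_minus_def)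
    moreover have "\<pi> (s l) = (\<Oplus>\<^bsub>S\<^esub>i\<in>T. \<pi> (h i l \<otimes> \<delta> i (fs ! l)))"
      unfolding s_def using l by (subst q.hom_finsum) (auto simp: comp_def)
    ultimately show ?thesis by (simp add: \<pi>_pow)
  qed
  \<comment> \<open>The left sides of \<open>A\<close>, one for each index in \<open>T\<close>,
    contribute \<open>card T\<close> copies of \<open>\<pi> y\<close>. After exchanging the sums,
    each inner sum over \<open>T\<close> is the one computed in \<open>B\<close>.\<close>
  have "\<pi> (euler y \<oplus> add_pow R (card T) y) = (\<Oplus>\<^bsub>S\<^esub>i\<in>T. \<pi> (x i \<otimes> \<delta> i y) \<oplus>\<^bsub>S\<^esub> \<pi> y)"
    unfolding euler_def
    by (subst q.S.finsum_addf)
      (auto simp: comp_def \<pi>_pow q.S.add.finprod_const intro!: finsum_closed)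
  also have "\<dots> = (\<Oplus>\<^bsub>S\<^esub>i\<in>T. \<Oplus>\<^bsub>S\<^esub>j\<in>{..<n}. \<pi> (h i j \<otimes> \<delta> i (fs ! j)))"
    using A by (intro q.S.finsum_cong') (auto intro!: q.S.finsum_closed)
  also have "\<dots> = (\<Oplus>\<^bsub>S\<^esub>j\<in>{..<n}. \<Oplus>\<^bsub>S\<^esub>i\<in>T. \<pi> (h i j \<otimes> \<delta> i (fs ! j)))"
    by (intro q.S.finsum_swap) auto
  also have "\<dots> = (\<Oplus>\<^bsub>S\<^esub>j\<in>{..<n}. add_pow S (d j) (\<pi> y))"
    using B by (intro q.S.finsum_cong') auto
  also have "\<dots> = \<pi> (add_pow R (\<Sum>j<n. d j) y)"
    by (simp add: q.S.finsum_add_pow \<pi>_pow)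
  finally show ?thesis
    by (subst (asm) \<pi>_eq) (auto simp: n_def I_def)
qed

end


section \<open>Polynomial rings\<close>

lemma finite_submultisets: "finite {k. k \<subseteq># m}"
proof (induction m)
  case (add a m)
  have "{k. k \<subseteq># add_mset a m} \<subseteq> {k. k \<subseteq># m} \<union> add_mset a ` {k. k \<subseteq># m}"
  proof
    fix k assume "k \<in> {k. k \<subseteq># add_mset a m}"
    then have k: "k \<subseteq># add_mset a m" by simp
    show "k \<in> {k. k \<subseteq># m} \<union> add_mset a ` {k. k \<subseteq># m}"
    proof (cases "a \<in># k")
      case True
      then obtain l where l: "k = add_mset a l" by (meson multi_member_split)
      then show ?thesis using k by auto
    next
      case False
      then have "k \<subseteq># m" using k
        by (metis add_mset_remove_trivial diff_single_trivial subset_eq_diff_conv add_mset_add_single)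
      then show ?thesis by simp
    qed
  qed
  then show ?case by (rule finite_subset) (use add in simp)
qed simp

lemma diff_diff_mset_cancel: "k \<subseteq># m \<Longrightarrow> m - (m - k) = k"
  by (simp add: multiset_eq_iff subseteq_mset_def)

section \<open>Convolution of coefficient functions\<close>

context cring
begin

text \<open>The product of \<open>mpoly_ring\<close>, taken on arbitrary coefficient functions so
  that its identities can be proved before closure of the polynomials under it.\<close>

definition conv :: "('c multiset \<Rightarrow> 'a) \<Rightarrow> ('c multiset \<Rightarrow> 'a) \<Rightarrow> ('c multiset \<Rightarrow> 'a)" where
  "conv P Q = (\<lambda>m. \<Oplus>k\<in>{k. k \<subseteq># m}. P k \<otimes> Q (m - k))"

lemma conv_carrier_coeff:
  assumes "carrier_coeff P" "carrier_coeff Q"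
  shows "carrier_coeff (conv P Q)"
  using assms unfolding carrier_coeff_def conv_def by (auto intro!: finsum_closed)

text \<open>This and the next two lemmas compute \<open>conv\<close> by recursion on its left
  factor, one for each rule generating \<open>indexed_pset\<close>. Closure, associativity and the
  Leibniz rule then follow by induction on that factor.\<close>

lemma conv_const:
  assumes "a \<in> carrier R" "carrier_coeff Q"
  shows "conv (indexed_const a) Q = (\<lambda>m. a \<otimes> Q m)"
proof
  fix m
  have "conv (indexed_const a) Q m = (\<Oplus>k\<in>{k. k \<subseteq># m}. if {#} = k then a \<otimes> Q (m - k) else \<zero>)"
    unfolding conv_def using assms
    by (intro finsum_cong') (auto simp: indexed_const_def carrier_coeff_def)
  also have "\<dots> = a \<otimes> Q (m - {#})"
    using assms by (intro finsum_singleton) (auto simp: finite_submultisets carrier_coeff_def)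
  finally show "conv (indexed_const a) Q m = a \<otimes> Q m" by simp
qed

lemma conv_padd_left:
  assumes "carrier_coeff P" "carrier_coeff P'" "carrier_coeff Q"
  shows "conv (indexed_padd P P') Q = indexed_padd (conv P Q) (conv P' Q)"
proof
  fix m
  have "conv (indexed_padd P P') Q m =
      (\<Oplus>k\<in>{k. k \<subseteq># m}. P k \<otimes> Q (m - k) \<oplus> P' k \<otimes> Q (m - k))"
    unfolding conv_def indexed_padd_def using assms
    by (intro finsum_cong') (auto simp: carrier_coeff_def l_distr)
  also have "\<dots> = indexed_padd (conv P Q) (conv P' Q) m"
    unfolding conv_def indexed_padd_def using assms
    by (intro finsum_addf) (auto simp: carrier_coeff_def)
  finally show "conv (indexed_padd P P') Q m = indexed_padd (conv P Q) (conv P' Q) m" .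
qed

text \<open>Only submultisets containing \<open>i\<close> contribute. If
  \<open>m = add_mset i m'\<close>, these correspond to the submultisets of \<open>m'\<close> by
  adding \<open>i\<close>.\<close>

lemma conv_pmult_left:
  assumes "carrier_coeff P" "carrier_coeff Q"
  shows "conv (indexed_pmult P i) Q = indexed_pmult (conv P Q) i"
proof
  fix m
  show "conv (indexed_pmult P i) Q m = indexed_pmult (conv P Q) i m"
  proof (cases "i \<in># m")
    case False
    have "conv (indexed_pmult P i) Q m = (\<Oplus>k\<in>{k. k \<subseteq># m}. \<zero>)"
      unfolding conv_def using assms False
      by (intro finsum_cong') (auto simp: carrier_coeff_def indexed_pmult_def dest: mset_subset_eqD)
    then show ?thesis using False by (simp add: indexed_pmult_def)
  next
    case True
    then obtain m' where m: "m = add_mset i m'" by (meson multi_member_split)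
    have "conv (indexed_pmult P i) Q m =
        (\<Oplus>k\<in>add_mset i ` {k. k \<subseteq># m'}. indexed_pmult P i k \<otimes> Q (m - k))"
      unfolding conv_def
    proof (rule add.finprod_mono_neutral_cong_right)
      show "indexed_pmult P i k \<otimes> Q (m - k) = \<zero>"
        if k: "k \<in> {k. k \<subseteq># m} - add_mset i ` {k. k \<subseteq># m'}" for k
      proof -
        have "i \<notin># k"
        proof
          assume "i \<in># k"
          then obtain l where "k = add_mset i l" by (meson multi_member_split)
          then show False using k m by auto
        qed
        then show "indexed_pmult P i k \<otimes> Q (m - k) = \<zero>"
          using assms by (simp add: indexed_pmult_def carrier_coeff_def)
      qed
    qed (use assms m in \<open>auto simp: finite_submultisets carrier_coeff_def indexed_pmult_def\<close>)
    also have "\<dots> = (\<Oplus>k\<in>{k. k \<subseteq># m'}. indexed_pmult P i (add_mset i k) \<otimes> Q (m - add_mset i k))"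
      using assms
      by (intro finsum_reindex) (auto simp: carrier_coeff_def indexed_pmult_def inj_on_def)
    also have "\<dots> = conv P Q m'"
      unfolding conv_def using assms
      by (intro finsum_cong') (auto simp: carrier_coeff_def indexed_pmult_def m)
    finally show ?thesis using True by (simp add: indexed_pmult_def m)
  qed
qed

text \<open>The complement \<open>m - k\<close> is an involution on the submultisets of
  \<open>m\<close> that exchanges the two factors.\<close>

lemma conv_commute:
  fixes P Q :: "'c multiset \<Rightarrow> 'a"
  assumes "carrier_coeff P" "carrier_coeff Q"
  shows "conv P Q = conv Q P"
proof
  fix m :: "'c multiset"
  have im: "(\<lambda>k. m - k) ` {k. k \<subseteq># m} = {k. k \<subseteq># m}"
  proof (intro equalityI subsetI)
    fix k assume "k \<in> {k. k \<subseteq># m}"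
    then have "k = m - (m - k)" "m - k \<in> {k. k \<subseteq># m}"
      by (auto simp: diff_diff_mset_cancel)
    then show "k \<in> (\<lambda>k. m - k) ` {k. k \<subseteq># m}" by blast
  qed auto
  have inj: "inj_on (\<lambda>k. m - k) {k. k \<subseteq># m}"
    by (rule inj_on_inverseI[where g = "\<lambda>k. m - k"]) (auto simp: diff_diff_mset_cancel)
  have "conv P Q m = (\<Oplus>k\<in>(\<lambda>k. m - k) ` {k. k \<subseteq># m}. P k \<otimes> Q (m - k))"
    unfolding conv_def im ..
  also have "\<dots> = (\<Oplus>k\<in>{k. k \<subseteq># m}. P (m - k) \<otimes> Q (m - (m - k)))"
    using assms inj by (intro finsum_reindex) (auto simp: carrier_coeff_def)
  also have "\<dots> = conv Q P m"
    unfolding conv_def using assms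
    by (intro finsum_cong') (auto simp: carrier_coeff_def diff_diff_mset_cancel m_comm)
  finally show "conv P Q m = conv Q P m" .
qed

end

section \<open>The polynomial ring as a commutative ring, and its coefficients\<close>

lemma (in ring) mpoly_ring_simps:
  "carrier (mpoly_ring R t) = indexed_pset {1..t} (carrier R)"
  "\<one>\<^bsub>mpoly_ring R t\<^esub> = indexed_const \<one>"
  "\<zero>\<^bsub>mpoly_ring R t\<^esub> = indexed_const \<zero>"
  "P \<oplus>\<^bsub>mpoly_ring R t\<^esub> Q = indexed_padd P Q"
  by (simp_all add: mpoly_ring_def)

context cring
begin

lemma mpoly_mult: "P \<otimes>\<^bsub>mpoly_ring R t\<^esub> Q = conv P Q"
  by (simp add: mpoly_ring_def conv_def)

lemma mpoly_carrier_coeff: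
  assumes "P \<in> carrier (mpoly_ring R t)"
  shows "carrier_coeff P"
  using indexed_pset_in_carrier[of "carrier R"] assms by (auto simp: mpoly_ring_simps)

lemma mpoly_coeff: "P \<in> carrier (mpoly_ring R t) \<Longrightarrow> P m \<in> carrier R"
  using mpoly_carrier_coeff unfolding carrier_coeff_def by blast

lemma mpoly_induct [consumes 1, case_names const padd pmult]:
  assumes "P \<in> carrier (mpoly_ring R t)"
    and "\<And>k. k \<in> carrier R \<Longrightarrow> Pr (indexed_const k)"
    and "\<And>P Q. P \<in> carrier (mpoly_ring R t) \<Longrightarrow> Pr P \<Longrightarrow> Q \<in> carrier (mpoly_ring R t) \<Longrightarrow> Pr Q \<Longrightarrow>
           Pr (indexed_padd P Q)"
    and "\<And>P i. P \<in> carrier (mpoly_ring R t) \<Longrightarrow> Pr P \<Longrightarrow> i \<in> {1..t} \<Longrightarrow> Pr (indexed_pmult P i)"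
  shows "Pr P"
  using assms(1) unfolding mpoly_ring_simps
  by (induction rule: indexed_pset.induct) (auto intro: assms simp: mpoly_ring_simps)

lemma mpoly_const_closed: "a \<in> carrier R \<Longrightarrow> indexed_const a \<in> carrier (mpoly_ring R t)"
  by (simp add: mpoly_ring_simps indexed_pset.indexed_const)

lemma mpoly_padd_closed:
  "P \<in> carrier (mpoly_ring R t) \<Longrightarrow> Q \<in> carrier (mpoly_ring R t) \<Longrightarrow>
   indexed_padd P Q \<in> carrier (mpoly_ring R t)"
  by (simp add: mpoly_ring_simps indexed_pset.indexed_padd)

lemma mpoly_pmult_closed:
  "P \<in> carrier (mpoly_ring R t) \<Longrightarrow> i \<in> {1..t} \<Longrightarrow> indexed_pmult P i \<in> carrier (mpoly_ring R t)"
  by (simp add: mpoly_ring_simps indexed_pset.indexed_pmult)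

lemma mpoly_var_closed: "i \<in> {1..t} \<Longrightarrow> indexed_var i \<in> carrier (mpoly_ring R t)"
  unfolding indexed_var_def by (simp add: mpoly_pmult_closed mpoly_const_closed)

text \<open>Needed twice: for products with a constant left factor, and for additive inverses, which
  are multiples by \<open>\<ominus> \<one>\<close>.\<close>

lemma mpoly_scalar_closed:
  assumes "P \<in> carrier (mpoly_ring R t)" "a \<in> carrier R"
  shows "(\<lambda>m. a \<otimes> P m) \<in> carrier (mpoly_ring R t)"
  using assms(1)
proof (induction rule: mpoly_induct)
  case (const k)
  have "(\<lambda>m. a \<otimes> indexed_const k m) = indexed_const (a \<otimes> k)"
    using assms(2) const by (auto simp: indexed_const_def)
  then show ?case using mpoly_const_closed[of "a \<otimes> k"] assms(2) const by (metis m_closed)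
next
  case (padd P Q)
  have "(\<lambda>m. a \<otimes> indexed_padd P Q m) = indexed_padd (\<lambda>m. a \<otimes> P m) (\<lambda>m. a \<otimes> Q m)"
    using assms(2) padd by (auto simp: indexed_padd_def r_distr mpoly_coeff)
  then show ?case using padd by (simp add: mpoly_padd_closed)
next
  case (pmult P i)
  have "(\<lambda>m. a \<otimes> indexed_pmult P i m) = indexed_pmult (\<lambda>m. a \<otimes> P m) i"
    using assms(2) by (auto simp: indexed_pmult_def)
  then show ?case using pmult by (simp add: mpoly_pmult_closed)
qed

lemma mpoly_conv_closed:
  assumes "P \<in> carrier (mpoly_ring R t)" "Q \<in> carrier (mpoly_ring R t)"
  shows "conv P Q \<in> carrier (mpoly_ring R t)"
  using assms(1)
proof (induction rule: mpoly_induct)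
  case (const k)
  then show ?case
    using assms(2) by (simp add: conv_const mpoly_carrier_coeff mpoly_scalar_closed)
next
  case (padd P P')
  then show ?case
    using assms(2) by (simp add: conv_padd_left mpoly_carrier_coeff mpoly_padd_closed)
next
  case (pmult P i)
  then show ?case
    using assms(2) by (simp add: conv_pmult_left mpoly_carrier_coeff mpoly_pmult_closed)
qed

text \<open>Induction on the leftmost factor alone avoids reindexing a double sum; a constant factor
  simply moves out of the convolution.\<close>

lemma mpoly_conv_assoc:
  assumes "P \<in> carrier (mpoly_ring R t)" "Q \<in> carrier (mpoly_ring R t)" "S \<in> carrier (mpoly_ring R t)"
  shows "conv (conv P Q) S = conv P (conv Q S)"
  using assms(1)
proof (induction rule: mpoly_induct)
  case (const k)
  have "conv (\<lambda>m. k \<otimes> Q m) S m = k \<otimes> conv Q S m" for m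
  proof -
    have "conv (\<lambda>m. k \<otimes> Q m) S m = (\<Oplus>l\<in>{l. l \<subseteq># m}. k \<otimes> (Q l \<otimes> S (m - l)))"
      unfolding conv_def using const assms
      by (intro finsum_cong') (auto simp: mpoly_coeff m_assoc)
    also have "\<dots> = k \<otimes> conv Q S m"
      unfolding conv_def using const assms
      by (intro finsum_rdistr[symmetric]) (auto simp: mpoly_coeff finite_submultisets)
    finally show ?thesis .
  qed
  then show ?case
    using const assms by (simp add: conv_const mpoly_carrier_coeff conv_carrier_coeff)
next
  case (padd P P')
  then show ?case
    using assms by (simp add: conv_padd_left mpoly_carrier_coeff conv_carrier_coeff)
next
  case (pmult P i)
  then show ?case
    using assms by (simp add: conv_pmult_left mpoly_carrier_coeff conv_carrier_coeff)
qed

lemma mpoly_ring_cring: "cring (mpoly_ring R t)"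
proof (rule cringI)
  note cc = mpoly_carrier_coeff
  show "abelian_group (mpoly_ring R t)"
  proof (rule abelian_groupI)
    fix P assume P: "P \<in> carrier (mpoly_ring R t)"
    then have "(\<lambda>m. \<ominus> \<one> \<otimes> P m) \<oplus>\<^bsub>mpoly_ring R t\<^esub> P = \<zero>\<^bsub>mpoly_ring R t\<^esub>"
      by (auto simp: mpoly_ring_simps(3,4) indexed_padd_def indexed_const_def mpoly_coeff
          l_minus l_neg)
    then show "\<exists>Q\<in>carrier (mpoly_ring R t). Q \<oplus>\<^bsub>mpoly_ring R t\<^esub> P = \<zero>\<^bsub>mpoly_ring R t\<^esub>"
      using mpoly_scalar_closed[OF P, of "\<ominus> \<one>"] by blast
    show "P \<oplus>\<^bsub>mpoly_ring R t\<^esub> Q = Q \<oplus>\<^bsub>mpoly_ring R t\<^esub> P"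
      if "P \<in> carrier (mpoly_ring R t)" "Q \<in> carrier (mpoly_ring R t)" for P Q
      using that by (simp add: mpoly_ring_simps(4) indexed_padd_def mpoly_coeff a_comm)
    show "P \<oplus>\<^bsub>mpoly_ring R t\<^esub> Q \<oplus>\<^bsub>mpoly_ring R t\<^esub> S = P \<oplus>\<^bsub>mpoly_ring R t\<^esub> (Q \<oplus>\<^bsub>mpoly_ring R t\<^esub> S)"
      if "P \<in> carrier (mpoly_ring R t)" "Q \<in> carrier (mpoly_ring R t)" "S \<in> carrier (mpoly_ring R t)"
      for P Q S
      using that by (simp add: mpoly_ring_simps(4) indexed_padd_def mpoly_coeff a_assoc)
  qed (simp_all add: mpoly_ring_simps(3,4) mpoly_padd_closed mpoly_const_closed indexed_padd_zero cc)
  show "comm_monoid (mpoly_ring R t)"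
    by (rule comm_monoidI)
      (auto simp: mpoly_mult mpoly_ring_simps(2) mpoly_conv_closed mpoly_const_closed
        conv_const cc mpoly_coeff mpoly_conv_assoc intro: conv_commute)
  show "(P \<oplus>\<^bsub>mpoly_ring R t\<^esub> Q) \<otimes>\<^bsub>mpoly_ring R t\<^esub> S =
      P \<otimes>\<^bsub>mpoly_ring R t\<^esub> S \<oplus>\<^bsub>mpoly_ring R t\<^esub> Q \<otimes>\<^bsub>mpoly_ring R t\<^esub> S"
    if "P \<in> carrier (mpoly_ring R t)" "Q \<in> carrier (mpoly_ring R t)" "S \<in> carrier (mpoly_ring R t)"
    for P Q S
    using that by (simp add: mpoly_mult mpoly_ring_simps(4) conv_padd_left cc)
qed

lemma mpoly_add_pow:
  fixes k :: nat
  shows "add_pow (mpoly_ring R t) k P m = add_pow R k (P m)"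
proof (induction k)
  case 0
  then show ?case by (simp add: add_pow_def nat_pow_def mpoly_ring_simps indexed_const_def)
next
  case (Suc k)
  then show ?case by (simp add: add_pow_def nat_pow_def mpoly_ring_simps indexed_padd_def)
qed

text \<open>Additive inverses in \<open>mpoly_ring\<close> are given only by the group structure, so
  their coefficients are identified through uniqueness of inverses in the base ring.\<close>

lemma mpoly_minus:
  assumes "P \<in> carrier (mpoly_ring R t)" "Q \<in> carrier (mpoly_ring R t)"
  shows "(P \<ominus>\<^bsub>mpoly_ring R t\<^esub> Q) m = P m \<ominus> Q m"
proof -
  interpret M: cring "mpoly_ring R t" by (rule mpoly_ring_cring)
  have "(\<ominus>\<^bsub>mpoly_ring R t\<^esub> Q \<oplus>\<^bsub>mpoly_ring R t\<^esub> Q) m = \<zero>"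
    using assms by (simp add: M.l_neg mpoly_ring_simps(3) indexed_const_def)
  then have "(\<ominus>\<^bsub>mpoly_ring R t\<^esub> Q) m \<oplus> Q m = \<zero>"
    by (simp add: mpoly_ring_simps(4) indexed_padd_def)
  then have "(\<ominus>\<^bsub>mpoly_ring R t\<^esub> Q) m = \<ominus> Q m"
    using assms by (intro minus_equality[symmetric]) (auto simp: mpoly_coeff[of _ t])
  then show ?thesis
    by (simp add: a_minus_def mpoly_ring_simps(4) indexed_padd_def)
qed

lemma mpoly_finsum:
  assumes "finite A" "\<And>i. i \<in> A \<Longrightarrow> f i \<in> carrier (mpoly_ring R t)"
  shows "finsum (mpoly_ring R t) f A m = (\<Oplus>i\<in>A. f i m)"
  using assms
proof (induction A rule: finite_induct)
  case empty
  interpret M: cring "mpoly_ring R t" by (rule mpoly_ring_cring)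
  show ?case by (simp add: mpoly_ring_simps(3) indexed_const_def)
next
  case (insert a A)
  interpret M: cring "mpoly_ring R t" by (rule mpoly_ring_cring)
  show ?case
    using insert
    by (subst M.finsum_insert; (subst finsum_insert)?)
      (auto simp: mpoly_ring_simps(4) indexed_padd_def mpoly_coeff[of _ t])
qed

lemma mpoly_var_mult:
  fixes P :: "nat multiset \<Rightarrow> 'a"
  assumes "P \<in> carrier (mpoly_ring R t)"
  shows "indexed_var i \<otimes>\<^bsub>mpoly_ring R t\<^esub> P = indexed_pmult P i"
proof -
  have "carrier_coeff (indexed_const \<one> :: nat multiset \<Rightarrow> 'a)" by (auto simp: carrier_coeff_def indexed_const_def)
  then show ?thesis
    using mpoly_carrier_coeff[OF assms]
    by (simp add: mpoly_mult indexed_var_def conv_pmult_left conv_const carrier_coeffE)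
qed

text \<open>Ensures in \<open>mpoly_euler\<close> that the exponents of the variables in
  \<open>{1..t}\<close> add up to the whole degree.\<close>

lemma mpoly_support:
  assumes "P \<in> carrier (mpoly_ring R t)" "P m \<noteq> \<zero>"
  shows "set_mset m \<subseteq> {1..t}"
  using assms
proof (induction arbitrary: m rule: mpoly_induct)
  case (const k)
  then show ?case by (auto simp: indexed_const_def split: if_splits)
next
  case (padd P Q)
  then have "P m \<noteq> \<zero> \<or> Q m \<noteq> \<zero>" by (auto simp: indexed_padd_def)
  then show ?case using padd.IH by blast
next
  case (pmult P i)
  then have "i \<in># m" "P (m - {#i#}) \<noteq> \<zero>" by (auto simp: indexed_pmult_def split: if_splits)
  then have "set_mset (m - {#i#}) \<subseteq> {1..t}" "m = add_mset i (m - {#i#})"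
    using pmult.IH by auto
  then show ?case using pmult.hyps by (metis insert_subset set_mset_add_mset_insert)
qed

text \<open>Provides the starting bound for the descent on degrees in
  \<open>colon_irrelevant_ideal\<close>.\<close>

lemma mpoly_degree_bound:
  assumes "P \<in> carrier (mpoly_ring R t)"
  shows "\<exists>N. \<forall>m. P m \<noteq> \<zero> \<longrightarrow> size m \<le> N"
  using assms
proof (induction rule: mpoly_induct)
  case (const k)
  then show ?case by (auto simp: indexed_const_def)
next
  case (padd P Q)
  then obtain N N' where "\<And>m. P m \<noteq> \<zero> \<Longrightarrow> size m \<le> N" "\<And>m. Q m \<noteq> \<zero> \<Longrightarrow> size m \<le> N'" by blast
  moreover have "P m \<noteq> \<zero> \<or> Q m \<noteq> \<zero>" if "indexed_padd P Q m \<noteq> \<zero>" for m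
    using that by (auto simp: indexed_padd_def)
  ultimately show ?case by (intro exI[of _ "max N N'"]) fastforce
next
  case (pmult P i)
  then obtain N where "\<And>m. P m \<noteq> \<zero> \<Longrightarrow> size m \<le> N" by blast
  then show ?case
    by (intro exI[of _ "Suc N"]) (auto simp: indexed_pmult_def size_Diff_singleton dest!: multi_member_split)
qed

section \<open>Formal partial derivatives and the Euler operator on polynomials\<close>

definition pdiff :: "'c \<Rightarrow> ('c multiset \<Rightarrow> 'a) \<Rightarrow> ('c multiset \<Rightarrow> 'a)" where
  "pdiff i P = (\<lambda>m. add_pow R (Suc (count m i)) (P (add_mset i m)))"

lemma pdiff_const: "pdiff i (indexed_const k) = indexed_const \<zero>"
  by (auto simp: pdiff_def indexed_const_def)

lemma pdiff_padd:
  assumes "carrier_coeff P" "carrier_coeff Q"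
  shows "pdiff i (indexed_padd P Q) = indexed_padd (pdiff i P) (pdiff i Q)"
  using assms
  by (simp add: pdiff_def indexed_padd_def carrier_coeff_def add.nat_pow_distrib fun_eq_iff
      del: add.nat_pow_Suc)

lemma pdiff_carrier_coeff: "carrier_coeff P \<Longrightarrow> carrier_coeff (pdiff i P)"
  by (simp add: carrier_coeff_def pdiff_def del: add.nat_pow_Suc)

text \<open>The product rule for one variable. For \<open>i = j\<close>, the factor
  \<open>Suc (count m i)\<close> splits into \<open>count m i\<close> copies from the differentiated
  polynomial and one from \<open>P\<close> itself.\<close>

lemma pdiff_pmult:
  assumes "carrier_coeff P"
  shows "pdiff i (indexed_pmult P j) =
    indexed_padd (indexed_pmult (pdiff i P) j) (if i = j then P else indexed_const \<zero>)"
proof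
  fix m
  have c: "P k \<in> carrier R" for k using assms by (simp add: carrier_coeff_def)
  show "pdiff i (indexed_pmult P j) m =
      indexed_padd (indexed_pmult (pdiff i P) j) (if i = j then P else indexed_const \<zero>) m"
  proof (cases "j \<in># m")
    case True
    then obtain m' where "m = add_mset j m'" by (meson multi_member_split)
    then show ?thesis
      using c by (auto simp: pdiff_def indexed_pmult_def indexed_padd_def indexed_const_def
          add_mset_commute)
  next
    case False
    then have "count m j = 0" by (simp add: not_in_iff)
    with False show ?thesis
      using c by (auto simp: pdiff_def indexed_pmult_def indexed_padd_def indexed_const_def)
  qed
qed

lemma pdiff_closed:
  assumes "P \<in> carrier (mpoly_ring R t)"
  shows "pdiff i P \<in> carrier (mpoly_ring R t)"
  using assms
proof (induction rule: mpoly_induct)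
  case (const k)
  then show ?case by (simp add: pdiff_const mpoly_const_closed)
next
  case (padd P Q)
  then show ?case by (simp add: pdiff_padd mpoly_carrier_coeff mpoly_padd_closed)
next
  case (pmult P j)
  then show ?case
    by (auto simp: pdiff_pmult mpoly_carrier_coeff intro!: mpoly_padd_closed mpoly_pmult_closed
        mpoly_const_closed)
qed

text \<open>The Leibniz rule, by induction on the left factor. Multiplication by the variable of
  differentiation adds the same term \<open>conv P Q\<close> to both sides; any other variable just
  passes through.\<close>

lemma pdiff_conv:
  assumes "P \<in> carrier (mpoly_ring R t)" "Q \<in> carrier (mpoly_ring R t)"
  shows "pdiff i (conv P Q) = indexed_padd (conv (pdiff i P) Q) (conv P (pdiff i Q))"
  using assms(1)
proof (induction rule: mpoly_induct)
  case (const k)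
  have Q: "carrier_coeff Q" using assms(2) by (rule mpoly_carrier_coeff)
  have "pdiff i (\<lambda>m. k \<otimes> Q m) = (\<lambda>m. k \<otimes> pdiff i Q m)"
    using const assms(2) by (simp add: pdiff_def add_pow_rdistr mpoly_coeff del: add.nat_pow_Suc)
  then show ?case
    using const Q
    by (simp add: pdiff_const conv_const pdiff_carrier_coeff)
      (simp add: indexed_padd_def carrier_coeffE pdiff_carrier_coeff)
next
  case (padd P P')
  note cc = padd.hyps[THEN mpoly_carrier_coeff] assms(2)[THEN mpoly_carrier_coeff]
  have "conv P (pdiff i Q) m \<in> carrier R" "conv P' (pdiff i Q) m \<in> carrier R"
    "conv (pdiff i P) Q m \<in> carrier R" "conv (pdiff i P') Q m \<in> carrier R" for m
    using cc by (auto intro!: carrier_coeffE conv_carrier_coeff pdiff_carrier_coeff)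
  with padd.IH cc show ?case
    by (simp add: conv_padd_left pdiff_padd conv_carrier_coeff pdiff_carrier_coeff)
      (simp add: indexed_padd_def a_ac)
next
  case (pmult P j)
  note cc = pmult.hyps(1)[THEN mpoly_carrier_coeff] assms(2)[THEN mpoly_carrier_coeff]
  note cc_rules = conv_carrier_coeff pdiff_carrier_coeff indexed_pmult_in_carrier
  have closed: "conv P Q m \<in> carrier R" "conv P (pdiff i Q) m \<in> carrier R"
    "conv (pdiff i P) Q m \<in> carrier R" for m
    using cc by (auto intro!: carrier_coeffE cc_rules)
  have r: "conv (indexed_pmult P j) (pdiff i Q) = indexed_pmult (conv P (pdiff i Q)) j"
    using cc by (simp add: conv_pmult_left cc_rules)
  show ?case
  proof (cases "i = j")
    case True
    have "pdiff i (conv (indexed_pmult P j) Q) =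
        indexed_padd (indexed_pmult (indexed_padd (conv (pdiff i P) Q) (conv P (pdiff i Q))) j) (conv P Q)"
      using pmult.IH cc True by (simp add: conv_pmult_left pdiff_pmult cc_rules)
    moreover have "conv (pdiff i (indexed_pmult P j)) Q =
        indexed_padd (indexed_pmult (conv (pdiff i P) Q) j) (conv P Q)"
      using cc True by (simp add: conv_pmult_left conv_padd_left pdiff_pmult cc_rules)
    ultimately show ?thesis
      unfolding r using closed by (auto simp: indexed_padd_def indexed_pmult_def a_ac)
  next
    case False
    have "pdiff i (conv (indexed_pmult P j) Q) =
        indexed_pmult (indexed_padd (conv (pdiff i P) Q) (conv P (pdiff i Q))) j"
      using pmult.IH cc False
      by (simp add: conv_pmult_left pdiff_pmult cc_rules indexed_padd_zero indexed_padd_in_carrier)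
    moreover have "conv (pdiff i (indexed_pmult P j)) Q = indexed_pmult (conv (pdiff i P) Q) j"
      using cc False by (simp add: conv_pmult_left pdiff_pmult cc_rules indexed_padd_zero)
    ultimately show ?thesis
      unfolding r by (auto simp: indexed_padd_def indexed_pmult_def)
  qed
qed

lemma pdiff_var: "pdiff i (indexed_var i) = indexed_const \<one>"
  by (auto simp: pdiff_def indexed_var_def indexed_pmult_def indexed_const_def)

lemma mpoly_derivations:
  "coordinate_derivations (mpoly_ring R t) {1..t} indexed_var pdiff"
proof -
  interpret M: cring "mpoly_ring R t" by (rule mpoly_ring_cring)
  show ?thesis
    by unfold_locales
      (auto simp: mpoly_var_closed pdiff_closed mpoly_ring_simps(2,4) pdiff_padd mpoly_mult
        mpoly_carrier_coeff pdiff_conv pdiff_var)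
qed

text \<open>Multiplying by the variable \<open>i\<close> undoes the index shift of
  \<open>pdiff i\<close>, so each summand scales the coefficient at \<open>m\<close> by the exponent
  of that variable.\<close>

lemma mpoly_euler:
  assumes "P \<in> carrier (mpoly_ring R t)"
  shows "coordinate_derivations.euler (mpoly_ring R t) {1..t} indexed_var pdiff P m =
    add_pow R (size m) (P m)"
proof -
  interpret M: coordinate_derivations "mpoly_ring R t" "{1..t}" indexed_var pdiff
    by (rule mpoly_derivations)
  have c: "P m \<in> carrier R" using mpoly_coeff[OF assms] .
  have "M.euler P m = (\<Oplus>i\<in>{1..t}. indexed_pmult (pdiff i P) i m)"
    unfolding M.euler_def using assms
    by (subst mpoly_finsum) (auto simp: mpoly_var_mult pdiff_closed mpoly_pmult_closed)
  also have "\<dots> = (\<Oplus>i\<in>{1..t}. add_pow R (count m i) (P m))"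
  proof (intro finsum_cong' funcsetI)
    fix i
    show "indexed_pmult (pdiff i P) i m = add_pow R (count m i) (P m)"
    proof (cases "i \<in># m")
      case True
      then obtain m' where "m = add_mset i m'" by (meson multi_member_split)
      then show ?thesis by (simp add: indexed_pmult_def pdiff_def)
    next
      case False
      then have "count m i = 0" by (simp add: not_in_iff)
      with False show ?thesis by (simp add: indexed_pmult_def)
    qed
  qed (use c in auto)
  also have "\<dots> = add_pow R (\<Sum>i\<in>{1..t}. count m i) (P m)"
    using c by (intro finsum_add_pow) auto
  \<comment> \<open>A monomial with variables outside \<open>{1..t}\<close> has a larger degree than
    the sum, but its coefficient is zero and so are both multiples.\<close>
  also have "\<dots> = add_pow R (size m) (P m)"
  proof (cases "P m = \<zero>")
    case False
    then have "(\<Sum>i\<in>{1..t}. count m i) = size m"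
      unfolding size_multiset_overloaded_eq
      using mpoly_support[OF assms] by (intro sum.mono_neutral_right) (auto simp: not_in_iff)
    then show ?thesis by simp
  qed simp
  finally show ?thesis .
qed


subsection \<open>The irrelevant ideal\<close>

lemma irrelevant_ideal_ideal: "ideal (irrelevant_ideal R t) (mpoly_ring R t)"
proof -
  interpret M: cring "mpoly_ring R t" by (rule mpoly_ring_cring)
  show ?thesis
    unfolding irrelevant_ideal_def by (intro M.genideal_ideal) (auto simp: mpoly_var_closed)
qed

lemma var_irrelevant_ideal: "i \<in> {1..t} \<Longrightarrow> indexed_var i \<in> irrelevant_ideal R t"
proof -
  interpret M: cring "mpoly_ring R t" by (rule mpoly_ring_cring)
  have "indexed_var ` {1..t} \<subseteq> carrier (mpoly_ring R t)" by (auto simp: mpoly_var_closed)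
  then show "i \<in> {1..t} \<Longrightarrow> indexed_var i \<in> irrelevant_ideal R t"
    unfolding irrelevant_ideal_def using M.genideal_self by blast
qed

text \<open>Every polynomial is constant modulo the variables: a multiple of a variable already lies
  in the ideal, and the other two cases preserve the form.\<close>

lemma irrelevant_ideal_decomp:
  assumes "P \<in> carrier (mpoly_ring R t)"
  shows "\<exists>a\<in>carrier R. \<exists>U\<in>irrelevant_ideal R t. P = indexed_padd (indexed_const a) U"
  using assms
proof (induction rule: mpoly_induct)
  interpret M: cring "mpoly_ring R t" by (rule mpoly_ring_cring)
  interpret J: ideal "irrelevant_ideal R t" "mpoly_ring R t" by (rule irrelevant_ideal_ideal)
  have z: "indexed_const \<zero> \<in> irrelevant_ideal R t"
    using J.zero_closed by (simp add: mpoly_ring_simps)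
  {
    case (const k)
    have "indexed_const k = indexed_padd (indexed_const k) (indexed_const \<zero>)"
      using const by (auto simp: indexed_padd_def indexed_const_def)
    then show ?case using const z by blast
  next
    case (padd P Q)
    then obtain a b U V where ab: "a \<in> carrier R" "b \<in> carrier R"
      and UV: "U \<in> irrelevant_ideal R t" "V \<in> irrelevant_ideal R t"
      and eq: "P = indexed_padd (indexed_const a) U" "Q = indexed_padd (indexed_const b) V"
      by blast
    have "U m \<in> carrier R" "V m \<in> carrier R" for m
      using J.Icarr[OF UV(1)] J.Icarr[OF UV(2)] mpoly_coeff by auto
    then have "indexed_padd P Q = indexed_padd (indexed_const (a \<oplus> b)) (indexed_padd U V)"
      unfolding eq using ab by (auto simp: indexed_padd_def indexed_const_def a_ac)
    moreover have "indexed_padd U V \<in> irrelevant_ideal R t"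
      using J.a_closed[OF UV] by (simp add: mpoly_ring_simps)
    ultimately show ?case using ab by blast
  next
    case (pmult P i)
    have "indexed_pmult P i \<in> irrelevant_ideal R t"
      using J.I_r_closed[OF var_irrelevant_ideal[OF pmult.hyps(2)] pmult.hyps(1)] pmult.hyps
      by (simp add: mpoly_var_mult)
    moreover have "indexed_pmult P i = indexed_padd (indexed_const \<zero>) (indexed_pmult P i)"
      using pmult.hyps(1)[THEN mpoly_carrier_coeff]
      by (simp add: indexed_padd_zero indexed_pmult_in_carrier)
    ultimately show ?case by blast
  }
qed

text \<open>The polynomials without constant term form an ideal containing the variables, which
  gives one inclusion. Conversely, comparing constant terms in
  \<open>irrelevant_ideal_decomp\<close> makes the constant summand vanish.\<close>

lemma irrelevant_ideal_iff:
  "P \<in> irrelevant_ideal R t \<longleftrightarrow> P \<in> carrier (mpoly_ring R t) \<and> P {#} = \<zero>"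
proof -
  interpret M: cring "mpoly_ring R t" by (rule mpoly_ring_cring)
  interpret J: ideal "irrelevant_ideal R t" "mpoly_ring R t" by (rule irrelevant_ideal_ideal)
  let ?K = "{P \<in> carrier (mpoly_ring R t). P {#} = \<zero>}"
  have conv0: "conv P Q {#} = P {#} \<otimes> Q {#}"
    if "P \<in> carrier (mpoly_ring R t)" "Q \<in> carrier (mpoly_ring R t)" for P Q
    using mpoly_coeff[OF that(1)] mpoly_coeff[OF that(2)] by (simp add: conv_def)
  have inv0: "(\<ominus>\<^bsub>mpoly_ring R t\<^esub> P) {#} = \<zero>"
    if "P \<in> carrier (mpoly_ring R t)" "P {#} = \<zero>" for P
    using mpoly_minus[of \<open>\<zero>\<^bsub>mpoly_ring R t\<^esub>\<close> t P "{#}"] that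
    by (simp add: a_minus_def) (simp add: mpoly_ring_simps(3) indexed_const_def)
  have "ideal ?K (mpoly_ring R t)"
  proof (intro idealI[OF M.ring_axioms] subgroup.intro)
    fix P assume "P \<in> ?K"
    then show "inv\<^bsub>add_monoid (mpoly_ring R t)\<^esub> P \<in> ?K"
      using inv0[of P] M.a_inv_closed[of P] by (simp add: a_inv_def)
  next
    fix P Q assume "P \<in> ?K" "Q \<in> ?K"
    then show "P \<otimes>\<^bsub>add_monoid (mpoly_ring R t)\<^esub> Q \<in> ?K"
      using M.a_closed[of P Q] by (simp add: mpoly_ring_simps(4) indexed_padd_def)
  next
    fix P Q assume "P \<in> ?K" "Q \<in> carrier (mpoly_ring R t)"
    then show "Q \<otimes>\<^bsub>mpoly_ring R t\<^esub> P \<in> ?K" "P \<otimes>\<^bsub>mpoly_ring R t\<^esub> Q \<in> ?K"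
      using M.m_closed[of P Q] M.m_closed[of Q P] mpoly_coeff[of Q t "{#}"]
      by (auto simp: mpoly_mult conv0)
  next
    show "\<one>\<^bsub>add_monoid (mpoly_ring R t)\<^esub> \<in> ?K"
      using M.zero_closed by (simp add: mpoly_ring_simps(3) indexed_const_def)
  qed auto
  moreover have "indexed_var ` {1..t} \<subseteq> ?K"
    by (auto simp: mpoly_var_closed) (simp add: indexed_var_def indexed_pmult_def)
  ultimately have "irrelevant_ideal R t \<subseteq> ?K"
    unfolding irrelevant_ideal_def by (rule M.genideal_minimal)
  moreover have "P \<in> irrelevant_ideal R t" if P: "P \<in> ?K"
  proof -
    obtain a U where a: "a \<in> carrier R" and U: "U \<in> irrelevant_ideal R t"
      and eq: "P = indexed_padd (indexed_const a) U"
      using irrelevant_ideal_decomp P by blast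
    have "U {#} = \<zero>" using U calculation by blast
    then have "a = \<zero>" using P a by (simp add: eq indexed_padd_def indexed_const_def)
    then have "P = U"
      using eq J.Icarr[OF U, THEN mpoly_carrier_coeff] by (simp add: indexed_padd_zero)
    then show ?thesis using U by simp
  qed
  ultimately show ?thesis by blast
qed

text \<open>A nonzero constant term forces \<open>n = 0\<close>, and then no other monomial can
  occur.\<close>

lemma graded_degree_0:
  assumes "P \<in> mpoly_grading R t n" "P \<notin> irrelevant_ideal R t"
  obtains c where "c \<in> carrier R" "c \<noteq> \<zero>" "P = indexed_const c"
proof
  have P: "P \<in> carrier (mpoly_ring R t)" "P m \<noteq> \<zero> \<longrightarrow> size m = n" for m
    using assms(1) by (auto simp: mpoly_grading_def)
  then show "P {#} \<noteq> \<zero>" using assms(2) irrelevant_ideal_iff by blast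
  then have "n = 0" using P(2)[of "{#}"] by simp
  then show "P = indexed_const (P {#})"
    using P(2) by (auto simp: indexed_const_def fun_eq_iff)
  show "P {#} \<in> carrier R" using P(1) by (rule mpoly_coeff)
qed

lemma euler_graded:
  assumes "P \<in> mpoly_grading R t n"
  shows "coordinate_derivations.euler (mpoly_ring R t) {1..t} indexed_var pdiff P =
    add_pow (mpoly_ring R t) n P"
proof
  fix m
  have P: "P \<in> carrier (mpoly_ring R t)" "P m \<noteq> \<zero> \<longrightarrow> size m = n"
    using assms by (auto simp: mpoly_grading_def)
  then show "coordinate_derivations.euler (mpoly_ring R t) {1..t} indexed_var pdiff P m =
      add_pow (mpoly_ring R t) n P m"
    by (cases "P m = \<zero>") (simp_all add: mpoly_euler mpoly_add_pow del: One_nat_def)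
qed

lemma contains_char_zero_field_Units:
  assumes "contains_char_zero_field R" "n > (0 :: nat)"
  shows "add_pow R n \<one> \<in> Units R"
proof -
  obtain k where k: "subfield k R" "add_pow R n \<one> \<noteq> \<zero>"
    using assms unfolding contains_char_zero_field_def by blast
  note sub = subringE[OF subfieldE(1)[OF k(1)]]
  \<comment> \<open>The subfield shares the identity of the ring, so it contains the positive
    integers together with their inverses.\<close>
  have "add_pow R j \<one> \<in> k" for j :: nat
    using sub by (induction j) auto
  then have "add_pow R n \<one> \<in> k - {\<zero>}" using k(2) by blast
  note inv = subfield_m_inv[OF k(1) this]
  have "add_pow R n \<one> \<in> carrier R" "inv (add_pow R n \<one>) \<in> carrier R"
    using inv(1) sub(1) by auto
  then show ?thesis using inv(2,3) unfolding Units_def by blast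
qed

text \<open>If the two multiples agreed for different numbers, the difference of the numbers would
  be a unit annihilating \<open>c\<close>.\<close>

lemma add_pow_cancel:
  assumes units: "\<And>n :: nat. n > 0 \<Longrightarrow> add_pow R n \<one> \<in> Units R"
    and c: "c \<in> carrier R" and eq: "add_pow R n c = add_pow R k c" and "c \<noteq> \<zero>"
  shows "n = (k :: nat)"
proof (rule ccontr)
  have aux: False if "n < k" "add_pow R n c = add_pow R k c" for n k :: nat
  proof -
    have "add_pow R n c \<oplus> add_pow R (k - n) c = add_pow R k c"
      using that(1) c by (simp add: add.nat_pow_mult)
    then have "add_pow R n c \<oplus> add_pow R (k - n) c = add_pow R n c \<oplus> \<zero>"
      using that(2) c by simp
    then have "add_pow R (k - n) c = \<zero>"
      using c by (simp add: add.l_cancel)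
    then have "add_pow R (k - n) \<one> \<otimes> c = \<zero>"
      using c by (simp add: add_pow_ldistr)
    moreover have u: "add_pow R (k - n) \<one> \<in> Units R" using units that by simp
    ultimately have "inv (add_pow R (k - n) \<one>) \<otimes> (add_pow R (k - n) \<one> \<otimes> c) = \<zero>" by simp
    then show False using u c \<open>c \<noteq> \<zero>\<close> by (simp flip: m_assoc)
  qed
  assume "n \<noteq> k"
  then show False using aux[of n k] aux[of k n] eq by (auto simp: neq_iff)
qed

text \<open>Multiplication by the constant polynomial with value the inverse of \<open>n\<close>
  recovers \<open>y\<close>.\<close>

lemma mpoly_ideal_divide:
  assumes I: "ideal I (mpoly_ring R t)" and y: "y \<in> carrier (mpoly_ring R t)"
    and n: "add_pow R n \<one> \<in> Units R" and mem: "add_pow (mpoly_ring R t) (n :: nat) y \<in> I"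
  shows "y \<in> I"
proof -
  interpret I: ideal I "mpoly_ring R t" by fact
  let ?u = "add_pow R n \<one>"
  have "indexed_const (inv ?u) \<otimes>\<^bsub>mpoly_ring R t\<^esub> add_pow (mpoly_ring R t) n y \<in> I"
    using I.I_l_closed[OF mem] n by (simp add: mpoly_const_closed)
  moreover have "indexed_const (inv ?u) \<otimes>\<^bsub>mpoly_ring R t\<^esub> add_pow (mpoly_ring R t) n y = y"
  proof
    fix m
    have c: "y m \<in> carrier R" using mpoly_coeff[OF y] .
    have "(indexed_const (inv ?u) \<otimes>\<^bsub>mpoly_ring R t\<^esub> add_pow (mpoly_ring R t) n y) m =
        inv ?u \<otimes> (?u \<otimes> y m)"
      using n c I.Icarr[OF mem, THEN mpoly_carrier_coeff]
      by (simp add: mpoly_mult conv_const mpoly_add_pow add_pow_ldistr)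
    then show "(indexed_const (inv ?u) \<otimes>\<^bsub>mpoly_ring R t\<^esub> add_pow (mpoly_ring R t) n y) m = y m"
      using n c by (simp flip: m_assoc)
  qed
  ultimately show ?thesis by simp
qed

text \<open>The linked ideal enters only through two of its elements, the constant \<open>c\<close>
  and the element \<open>y\<close> to be placed in \<open>I\<close>.\<close>

lemma colon_irrelevant_ideal:
  assumes units: "\<And>n :: nat. n > 0 \<Longrightarrow> add_pow R n \<one> \<in> Units R"
    and hom: "set fs \<subseteq> (\<Union>n. mpoly_grading R t n)"
    and reg: "regular_sequence (mpoly_ring R t) fs"
    and I: "I = genideal (mpoly_ring R t) (set fs)" "I \<subseteq> irrelevant_ideal R t"
    and c: "c \<in> carrier R" "c \<noteq> \<zero>"
      "\<And>i. i \<in> {1..t} \<Longrightarrow> indexed_const c \<otimes>\<^bsub>mpoly_ring R t\<^esub> indexed_var i \<in> I"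
    and y: "y \<in> irrelevant_ideal R t"
      "\<And>i. i \<in> {1..t} \<Longrightarrow> y \<otimes>\<^bsub>mpoly_ring R t\<^esub> indexed_var i \<in> I"
  shows "y \<in> I"
proof -
  let ?M = "mpoly_ring R t"
  note [simp del] = One_nat_def \<comment> \<open>it would rewrite the parameter \<open>{1..t}\<close> of \<open>M.euler\<close>\<close>
  interpret M: coordinate_derivations ?M "{1..t}" indexed_var pdiff
    by (rule mpoly_derivations)
  have fs: "set fs \<subseteq> carrier ?M" using reg unfolding regular_sequence_def by blast
  interpret I: ideal I ?M unfolding I(1) using M.genideal_ideal[OF fs] .
  have "\<forall>j. \<exists>d. j < length fs \<longrightarrow> fs ! j \<in> mpoly_grading R t d"
    using hom nth_mem by blast
  then obtain d where d: "\<And>j. j < length fs \<Longrightarrow> fs ! j \<in> mpoly_grading R t (d j)" by metis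
  define D where "D = (\<Sum>j<length fs. d j)"
  have colon: "(M.euler z \<oplus>\<^bsub>?M\<^esub> add_pow ?M t z) \<ominus>\<^bsub>?M\<^esub> add_pow ?M D z \<in> I"
    if "z \<in> carrier ?M" "\<And>i. i \<in> {1..t} \<Longrightarrow> z \<otimes>\<^bsub>?M\<^esub> indexed_var i \<in> I" for z
    using M.euler_colon[OF fs _ _ that(1), of d] that(2) reg euler_graded[OF d]
    unfolding regular_sequence_def D_def I(1) by simp
  have "t = D"
  proof -
    have cM: "indexed_const c \<in> carrier ?M" using c by (simp add: mpoly_const_closed)
    let ?z = "M.euler (indexed_const c) \<oplus>\<^bsub>?M\<^esub> add_pow ?M t (indexed_const c)"
    have c0: "indexed_const c ({#} :: nat multiset) = c" by (simp add: indexed_const_def)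
    have z: "?z \<in> carrier ?M" using cM by (simp)
    have "?z {#} = add_pow R t c"
      using cM c(1) c0
      by (simp add: mpoly_ring_simps(4) indexed_padd_def mpoly_euler mpoly_add_pow)
    \<comment> \<open>Constant terms are compared: those of \<open>I\<close> vanish because
      \<open>I\<close> lies in the irrelevant ideal, and the Euler term contributes nothing in
      degree zero.\<close>
    moreover have "(?z \<ominus>\<^bsub>?M\<^esub> add_pow ?M D (indexed_const c)) {#} = \<zero>"
      using colon[OF cM c(3)] I(2) irrelevant_ideal_iff by blast
    ultimately have "add_pow R t c \<ominus> add_pow R D c = \<zero>"
      using mpoly_minus[OF z, of "add_pow ?M D (indexed_const c)" "{#}"] cM c0
      by (simp add: mpoly_add_pow)
    then have "add_pow R t c = add_pow R D c" using c(1) by (simp add: r_right_minus_eq)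
    then show ?thesis using add_pow_cancel[OF units c(1) _ c(2)] by blast
  qed
  \<comment> \<open>The generators are homogeneous, hence only scaled by \<open>M.euler\<close>.
    Stability of \<open>I\<close> is needed because the descent below applies the operator
    again.\<close>
  have euler_I: "M.euler z \<in> I" if "z \<in> I" for z
  proof -
    have "M.euler f \<in> I" if f: "f \<in> set fs" for f
    proof -
      have "f \<in> I" using f M.genideal_self[OF fs] I(1) by auto
      moreover obtain n where "f \<in> mpoly_grading R t n" using f hom by blast
      ultimately show ?thesis by (simp add: euler_graded I.add_pow_mem)
    qed
    then show ?thesis using M.euler_genideal[OF fs] that unfolding I(1) by blast
  qed
  have yM: "y \<in> carrier ?M" "y {#} = \<zero>" using y(1) irrelevant_ideal_iff by auto
  have "M.euler y \<in> I"
  proof -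
    have "(M.euler y \<oplus>\<^bsub>?M\<^esub> add_pow ?M t y) \<ominus>\<^bsub>?M\<^esub> add_pow ?M t y = M.euler y"
      using yM(1) by (simp add: a_minus_def M.a_assoc M.r_neg)
    then show ?thesis using colon[OF yM(1) y(2)] \<open>t = D\<close>[symmetric] by simp
  qed
  \<comment> \<open>Instead of extracting homogeneous components, the induction removes the top
    degree. It is stated for general \<open>z\<close>, since each step replaces \<open>z\<close> by
    another polynomial with a smaller bound.\<close>
  moreover have "z \<in> I"
    if "z \<in> carrier ?M" "\<And>m. z m \<noteq> \<zero> \<Longrightarrow> 0 < size m \<and> size m \<le> N" "M.euler z \<in> I" for z N
    using that
  proof (induction N arbitrary: z)
    case 0
    have "z m = \<zero>" for m using "0.prems"(2)[of m] by (metis leD)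
    then have "z = indexed_const \<zero>" by (auto simp: indexed_const_def)
    then show ?case using I.zero_closed by (simp add: mpoly_ring_simps)
  next
    case (Suc N)
    \<comment> \<open>\<open>?w\<close> has no terms of degree \<open>Suc N\<close>.\<close>
    let ?w = "M.euler z \<ominus>\<^bsub>?M\<^esub> add_pow ?M (Suc N) z"
    have wm: "?w m = add_pow R (size m) (z m) \<ominus> add_pow R (Suc N) (z m)" for m
      using Suc.prems(1) by (simp add: mpoly_minus mpoly_euler mpoly_add_pow del: M.add.nat_pow_Suc add.nat_pow_Suc)
    note zM = Suc.prems(1) and zI = Suc.prems(3)
    have pow_I: "M.euler (add_pow ?M k z) \<in> I" for k :: nat
    proof (induction k)
      case 0
      then show ?case using I.zero_closed by (simp add: M.euler_zero)
    next
      case (Suc k)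
      then show ?case using zI zM by (simp add: M.euler_add)
    qed
    have "?w \<in> I"
    proof (rule Suc.IH)
      show "?w \<in> carrier ?M" using Suc.prems by simp
      show "0 < size m \<and> size m \<le> N" if "?w m \<noteq> \<zero>" for m
      proof -
        have c: "z m \<in> carrier R" using mpoly_coeff[OF Suc.prems(1)] .
        have "z m \<noteq> \<zero>" "size m \<noteq> Suc N"
          using that c unfolding wm by (auto simp: a_minus_def r_neg simp del: add.nat_pow_Suc)
        then show ?thesis using Suc.prems(2)[of m] by linarith
      qed
      have "M.euler ?w = M.euler (M.euler z) \<ominus>\<^bsub>?M\<^esub> M.euler (add_pow ?M (Suc N) z)"
        using zM unfolding a_minus_def by (subst M.euler_add) (auto simp: M.euler_a_inv simp del: M.add.nat_pow_Suc)
      then show "M.euler ?w \<in> I"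
        using euler_I[OF zI] pow_I[of "Suc N"] unfolding a_minus_def by (simp del: M.add.nat_pow_Suc)
    qed
    \<comment> \<open>Both \<open>M.euler z\<close> and its difference \<open>?w\<close> from this
      multiple lie in \<open>I\<close>; the factor \<open>Suc N\<close> is then inverted.\<close>
    then have "add_pow ?M (Suc N) z \<in> I"
      using I.minus_mem_cancel[OF zI] zM by blast
    then show ?case
      using mpoly_ideal_divide[OF I.is_ideal Suc.prems(1) units[of "Suc N"]] by simp
  qed
  moreover obtain N where "\<And>m. y m \<noteq> \<zero> \<Longrightarrow> size m \<le> N"
    using mpoly_degree_bound[OF yM(1)] by blast
  \<comment> \<open>The constant term of \<open>y\<close> is zero, so all its monomials have
    positive degree, as the descent requires.\<close>
  ultimately show ?thesis
    using yM by (metis size_eq_0_iff_empty neq0_conv)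
qed

end


section \<open>Linkage with the irrelevant ideal\<close>

text \<open>Some homogeneous generator of \<aa> lies outside the irrelevant ideal, as otherwise
  minimality would put \<aa> inside it. That generator is a nonzero constant, and the colon
  condition makes it multiply all variables into \<open>I\<close>.\<close>

lemma (in cring) linked_irrelevant_ideal_Int:
  assumes char0: "contains_char_zero_field R"
    and a: "homogeneous_ideal (mpoly_ring R t) (mpoly_grading R t) \<aa>"
      "\<not> \<aa> \<subseteq> irrelevant_ideal R t"
    and colon: "\<aa> = ideal_colon (mpoly_ring R t) I (irrelevant_ideal R t)"
    and I: "I \<subseteq> irrelevant_ideal R t"
      "set fs \<subseteq> (\<Union>n. mpoly_grading R t n)" "regular_sequence (mpoly_ring R t) fs"
      "I = genideal (mpoly_ring R t) (set fs)"
  shows "\<aa> \<inter> irrelevant_ideal R t \<subseteq> I"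
proof -
  let ?M = "mpoly_ring R t"
  interpret M: cring ?M by (rule mpoly_ring_cring)
  obtain S where S: "S \<subseteq> (\<Union>n. mpoly_grading R t n)" "\<aa> = genideal ?M S"
    using a(1) unfolding homogeneous_ideal_def by blast
  then have SM: "S \<subseteq> carrier ?M" unfolding mpoly_grading_def by blast
  obtain s n where s: "s \<in> S" "s \<notin> irrelevant_ideal R t" "s \<in> mpoly_grading R t n"
    using a(2) S M.genideal_minimal[OF irrelevant_ideal_ideal, of S] by blast
  obtain c where c: "c \<in> carrier R" "c \<noteq> \<zero>" "s = indexed_const c"
    using graded_degree_0[OF s(3,2)] .
  have var: "z \<otimes>\<^bsub>?M\<^esub> indexed_var i \<in> I" if "z \<in> \<aa>" "i \<in> {1..t}" for z i
    using that var_irrelevant_ideal[OF that(2)] mpoly_var_closed[OF that(2)]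
    unfolding colon ideal_colon_def by (auto simp: M.m_comm)
  have "s \<in> \<aa>" using s(1) M.genideal_self[OF SM] S(2) by blast
  then have "y \<in> I" if "y \<in> \<aa>" "y \<in> irrelevant_ideal R t" for y
    using colon_irrelevant_ideal[OF contains_char_zero_field_Units[OF char0] I(2,3,4,1) c(1,2) _ that(2)]
      var c(3) that(1) by blast
  then show ?thesis by blast
qed

theorem proposition2p8:
  fixes R\<^sub>0 :: "('a, 'b) ring_scheme" and \<mm>\<^sub>0 :: "'a set" and t :: nat
    and R :: "(nat multiset \<Rightarrow> 'a) ring"
    and G :: "nat \<Rightarrow> (nat multiset \<Rightarrow> 'a) set"
    and Rplus :: "(nat multiset \<Rightarrow> 'a) set"
  assumes "regular_local_ring R\<^sub>0 \<mm>\<^sub>0"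
    and "contains_char_zero_field R\<^sub>0"
  defines "R \<equiv> mpoly_ring R\<^sub>0 t"
    and "G \<equiv> mpoly_grading R\<^sub>0 t"
    and "Rplus \<equiv> irrelevant_ideal R\<^sub>0 t"
  shows "(\<forall>\<aa>. homogeneous_ideal R G \<aa> \<and> Rplus \<subset> \<aa> \<longrightarrow> \<not> (\<exists>I. h_linked R G I Rplus \<aa>)) \<and>
         (\<forall>\<aa> I. homogeneous_ideal R G \<aa> \<and> \<not> \<aa> \<subseteq> Rplus \<and> h_linked R G I \<aa> Rplus \<longrightarrow>
            geometrically_h_linked R G I \<aa> Rplus)"
proof -
  interpret R0: cring R\<^sub>0
    using assms(1) unfolding regular_local_ring_def local_ring_def by blast
  interpret R: cring R unfolding R_def by (rule R0.mpoly_ring_cring)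
  \<comment> \<open>Common to both claims: linkage supplies this colon equation in either order of
    the two ideals.\<close>
  have Int: "\<aa> \<inter> Rplus \<subseteq> I"
    if "homogeneous_ideal R G \<aa>" "\<not> \<aa> \<subseteq> Rplus" "\<aa> = ideal_colon R I Rplus" "I \<subseteq> Rplus"
      and "\<exists>fs. set fs \<subseteq> (\<Union>n. G n) \<and> regular_sequence R fs \<and> I = genideal R (set fs)" for \<aa> I
    using that(5) R0.linked_irrelevant_ideal_Int[OF assms(2) that(1-4)[unfolded R_def G_def Rplus_def]]
    unfolding R_def G_def Rplus_def by blast
  show ?thesis
  proof (intro conjI allI impI notI)
    fix \<aa> assume a: "homogeneous_ideal R G \<aa> \<and> Rplus \<subset> \<aa>"
    assume "\<exists>I. h_linked R G I Rplus \<aa>"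
    then obtain I where I: "h_linked R G I Rplus \<aa>" by blast
    then have colon: "\<aa> = ideal_colon R I Rplus" and proper: "\<aa> \<noteq> carrier R"
      and fs: "\<exists>fs. set fs \<subseteq> (\<Union>n. G n) \<and> regular_sequence R fs \<and> I = genideal R (set fs)"
      and sub: "I \<subseteq> Rplus"
      unfolding h_linked_def by blast+
    \<comment> \<open>Strict inclusion makes \<open>Int\<close> applicable and reduces the
      intersection to \<open>Rplus\<close>. Then the identity lies in the colon ideal \<aa>, against
      properness.\<close>
    have "Rplus \<subseteq> I" using Int[OF _ _ colon sub fs] a by blast
    moreover have "Rplus \<subseteq> carrier R"
      using R0.irrelevant_ideal_iff unfolding Rplus_def R_def by blast
    ultimately have "s \<otimes>\<^bsub>R\<^esub> \<one>\<^bsub>R\<^esub> \<in> I" if "s \<in> Rplus" for s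
      using that by (metis R.r_one subsetD)
    then have "\<one>\<^bsub>R\<^esub> \<in> ideal_colon R I Rplus"
      unfolding ideal_colon_def by blast
    moreover have "ideal \<aa> R" using a unfolding homogeneous_ideal_def by blast
    ultimately show False
      using proper ideal.one_imp_carrier colon by blast
  next
    fix \<aa> I
    assume a: "homogeneous_ideal R G \<aa> \<and> \<not> \<aa> \<subseteq> Rplus \<and> h_linked R G I \<aa> Rplus"
    then have "\<aa> = ideal_colon R I Rplus" "I \<subseteq> \<aa> \<inter> Rplus"
      "\<exists>fs. set fs \<subseteq> (\<Union>n. G n) \<and> regular_sequence R fs \<and> I = genideal R (set fs)"
      unfolding h_linked_def by blast+
    then have "\<aa> \<inter> Rplus = I" using Int[of \<aa> I] a by blast
    then show "geometrically_h_linked R G I \<aa> Rplus"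
      using a unfolding geometrically_h_linked_def by blast
  qed
qed

end
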